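(* (Goursat's Lemma for crossed groups) Let $\mathcal A$ be a small category. Suppose $G$ is a crossed $\mathcal A$-group which is a virtual product of crossed $\mathcal A$-subgroups $G^{(1)},G^{(2)}\subset G$. Then there is a one-to-one correspondence between the following data: (a) a crossed $\mathcal A$-subgroup $H$ of $G$; (b) a quintuple $(\widetilde H^{(1)},H^{(1)};\widetilde H^{(2)},H^{(2)};\chi)$ consisting of (i) crossed $\mathcal A$-subgroups $H^{(i)}\subset\widetilde H^{(i)}\subset G^{(i)}$ for $i=1,2$ such that $H^{(i)}(a)$ is a normal subgroup of $\widetilde H^{(i)}(a)$ for each $a\in\mathcal A$; and (ii) a map $\chi:\widetilde H^{(1)}/H^{(1)}\to\widetilde H^{(2)}/H^{(2)}$ of $\mathcal A$-sets which is a degreewise group isomorphism.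
   Context: Let $\mathcal A$ be a small category. An $\mathcal A$-set is a presheaf of sets on $\mathcal A$. A crossed $\mathcal A$-group is an $\mathcal A$-set $G$ together with a group structure on each $G(a)$ and a left action $G(b)\times\mathcal A(a,b)\to\mathcal A(a,b)$, $(x,\varphi)\mapsto\varphi^x$, of the group $G(b)$ for all $a,b$, such that: (i) $(\psi\varphi)^x=\psi^x\varphi^{\psi^\ast(x)}$ for $\varphi:a\to b$, $\psi:b\to c$, $x\in G(c)$; (ii) $\varphi^\ast(xy)=(\varphi^y)^\ast(x)\varphi^\ast(y)$ for $\varphi:a\to b$, $x,y\in G(b)$. A map of crossed $\mathcal A$-groups is a map of $\mathcal A$-sets which is degreewise a group homomorphism and respects the actions on the $\mathcal A(a,b)$; they form the category $\mathbf{CrsGrp}_{\mathcal A}$, which is cocomplete. A crossed $\mathcal A$-subgroup of $G$ is a sub-$\mathcal A$-set which is degreewise a subgroup, with the restricted actions. $G^{(1)}\ast G^{(2)}$ denotes the coproduct in $\mathbf{CrsGrp}_{\mathcal A}$ (degreewise the free product of groups). A crossed $\mathcal A$-group $G$ is a virtual product of crossed $\mathcal A$-subgroups $G^{(1)},G^{(2)}$ if: (i) the map $G^{(1)}\ast G^{(2)}\to G$ induced by the inclusions is an epimorphism in $\mathbf{CrsGrp}_{\mathcal A}$; (ii) the pullback $G^{(1)}\times_G G^{(2)}$ (degreewise the intersection) is trivial; (iii) for each $a\in\mathcal A$, the commutator subgroup $[G^{(1)}(a),G^{(2)}(a)]\subset G(a)$ is trivial. If $N\subset H$ is a crossed $\mathcal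 A$-subgroup with $N(a)$ normal in $H(a)$ for every $a$, then $H/N$ denotes the family $\{H(a)/N(a)\}_a$ with its quotient group structures and its unique $\mathcal A$-set structure for which the projections $H(a)\to H(a)/N(a)$ form a map of $\mathcal A$-sets. *)

theory Defs
  imports "HOL-Algebra.Group_Action" "HOL-Algebra.Generated_Groups"
begin

section \<open>Small categories and presheaves of sets\<close>

record ('o, 'm) cat =
  Obj :: "'o set"
  Arr :: "'m set"
  Dom :: "'m \<Rightarrow> 'o"
  Cod :: "'m \<Rightarrow> 'o"
  Ident :: "'o \<Rightarrow> 'm"
  Comp :: "'m \<Rightarrow> 'm \<Rightarrow> 'm"

definition Hom :: "('o, 'm) cat \<Rightarrow> 'o \<Rightarrow> 'o \<Rightarrow> 'm set" where
  "Hom A a b = {\<phi> \<in> Arr A. Dom A \<phi> = a \<and> Cod A \<phi> = b}"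

text \<open>\<open>Comp A \<psi> \<phi>\<close> is the composite \<open>\<psi>\<phi>\<close>, i.e. \<open>\<phi>\<close> comes first.\<close>

locale small_category =
  fixes A :: "('o, 'm) cat"
  assumes Dom_Obj: "\<phi> \<in> Arr A \<Longrightarrow> Dom A \<phi> \<in> Obj A"
    and Cod_Obj: "\<phi> \<in> Arr A \<Longrightarrow> Cod A \<phi> \<in> Obj A"
    and Ident_Hom: "a \<in> Obj A \<Longrightarrow> Ident A a \<in> Hom A a a"
    and Comp_Hom: "\<phi> \<in> Hom A a b \<Longrightarrow> \<psi> \<in> Hom A b c \<Longrightarrow> Comp A \<psi> \<phi> \<in> Hom A a c"
    and Comp_Ident_right: "\<phi> \<in> Hom A a b \<Longrightarrow> Comp A \<phi> (Ident A a) = \<phi>"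
    and Comp_Ident_left: "\<phi> \<in> Hom A a b \<Longrightarrow> Comp A (Ident A b) \<phi> = \<phi>"
    and Comp_assoc: "\<phi> \<in> Hom A a b \<Longrightarrow> \<psi> \<in> Hom A b c \<Longrightarrow> \<theta> \<in> Hom A c d \<Longrightarrow>
      Comp A \<theta> (Comp A \<psi> \<phi>) = Comp A (Comp A \<theta> \<psi>) \<phi>"

locale presheaf = small_category A
  for A :: "('o, 'm) cat" +
  fixes F :: "'o \<Rightarrow> 'x set" and p :: "'m \<Rightarrow> 'x \<Rightarrow> 'x"
  assumes p_closed: "\<phi> \<in> Hom A a b \<Longrightarrow> x \<in> F b \<Longrightarrow> p \<phi> x \<in> F a"
    and p_Ident: "a \<in> Obj A \<Longrightarrow> x \<in> F a \<Longrightarrow> p (Ident A a) x = x"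
    and p_Comp: "\<phi> \<in> Hom A a b \<Longrightarrow> \<psi> \<in> Hom A b c \<Longrightarrow> x \<in> F c \<Longrightarrow>
      p (Comp A \<psi> \<phi>) x = p \<phi> (p \<psi> x)"

definition presheaf_map ::
  "('o, 'm) cat \<Rightarrow> ('o \<Rightarrow> 'x set) \<Rightarrow> ('m \<Rightarrow> 'x \<Rightarrow> 'x) \<Rightarrow>
    ('o \<Rightarrow> 'y set) \<Rightarrow> ('m \<Rightarrow> 'y \<Rightarrow> 'y) \<Rightarrow> ('o \<Rightarrow> 'x \<Rightarrow> 'y) \<Rightarrow> bool" where
  "presheaf_map A F p F' p' h \<longleftrightarrow>
    (\<forall>a\<in>Obj A. h a \<in> F a \<rightarrow> F' a) \<and>
    (\<forall>a\<in>Obj A. \<forall>b\<in>Obj A. \<forall>\<phi>\<in>Hom A a b. \<forall>x\<in>F b. h a (p \<phi> x) = p' \<phi> (h b x))"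


section \<open>Crossed groups\<close>

text \<open>For \<open>\<phi> : a \<rightarrow> b\<close> and \<open>x \<in> G(b)\<close>, \<open>pull G \<phi> x\<close> is \<open>\<phi>\<^sup>*(x)\<close> and \<open>act G x \<phi>\<close> is \<open>\<phi>\<^sup>x\<close>.\<close>

record ('o, 'm, 'g) crossed =
  grp :: "'o \<Rightarrow> 'g monoid"
  pull :: "'m \<Rightarrow> 'g \<Rightarrow> 'g"
  act :: "'g \<Rightarrow> 'm \<Rightarrow> 'm"

abbreviation elts :: "('o, 'm, 'g) crossed \<Rightarrow> 'o \<Rightarrow> 'g set" where
  "elts G a \<equiv> carrier (grp G a)"

locale crossed_group = presheaf A "elts G" "pull G"
  for A :: "('o, 'm) cat" and G :: "('o, 'm, 'g) crossed" +
  assumes grp: "a \<in> Obj A \<Longrightarrow> group (grp G a)"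
    and action: "a \<in> Obj A \<Longrightarrow> b \<in> Obj A \<Longrightarrow>
      group_action (grp G b) (Hom A a b) (\<lambda>x. \<lambda>\<phi>\<in>Hom A a b. act G x \<phi>)"
    and act_Comp: "\<phi> \<in> Hom A a b \<Longrightarrow> \<psi> \<in> Hom A b c \<Longrightarrow> x \<in> elts G c \<Longrightarrow>
      act G x (Comp A \<psi> \<phi>) = Comp A (act G x \<psi>) (act G (pull G \<psi> x) \<phi>)"
    and pull_mult: "\<phi> \<in> Hom A a b \<Longrightarrow> x \<in> elts G b \<Longrightarrow> y \<in> elts G b \<Longrightarrow>
      pull G \<phi> (x \<otimes>\<^bsub>grp G b\<^esub> y) = pull G (act G y \<phi>) x \<otimes>\<^bsub>grp G a\<^esub> pull G \<phi> y"

definition crossed_hom ::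
  "('o, 'm) cat \<Rightarrow> ('o, 'm, 'g) crossed \<Rightarrow> ('o, 'm, 'h) crossed \<Rightarrow> ('o \<Rightarrow> 'g \<Rightarrow> 'h) \<Rightarrow> bool" where
  "crossed_hom A G H f \<longleftrightarrow>
    presheaf_map A (elts G) (pull G) (elts H) (pull H) f \<and>
    (\<forall>a\<in>Obj A. f a \<in> hom (grp G a) (grp H a)) \<and>
    (\<forall>a\<in>Obj A. \<forall>b\<in>Obj A. \<forall>\<phi>\<in>Hom A a b. \<forall>x\<in>elts G b. act H (f b x) \<phi> = act G x \<phi>)"

definition crossed_subgroup :: "('o, 'm) cat \<Rightarrow> ('o, 'm, 'g) crossed \<Rightarrow> ('o \<Rightarrow> 'g set) \<Rightarrow> bool" where
  "crossed_subgroup A G K \<longleftrightarrow>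
    (\<forall>a\<in>Obj A. subgroup (K a) (grp G a)) \<and>
    (\<forall>a\<in>Obj A. \<forall>b\<in>Obj A. \<forall>\<phi>\<in>Hom A a b. \<forall>x\<in>K b. pull G \<phi> x \<in> K a)"

definition sub :: "('o, 'm, 'g) crossed \<Rightarrow> ('o \<Rightarrow> 'g set) \<Rightarrow> ('o, 'm, 'g) crossed" where
  "sub G K = \<lparr>grp = \<lambda>a. (grp G a)\<lparr>carrier := K a\<rparr>, pull = pull G, act = act G\<rparr>"

text \<open>A family indexed by the objects is represented by a function that is \<open>undefined\<close> off
  \<open>Obj A\<close>, so that equality of such functions is equality of families.\<close>

definition crossed_subgroups :: "('o, 'm) cat \<Rightarrow> ('o, 'm, 'g) crossed \<Rightarrow> ('o \<Rightarrow> 'g set) set" where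
  "crossed_subgroups A G = {K \<in> extensional (Obj A). crossed_subgroup A G K}"


section \<open>Coproducts\<close>

text \<open>The free product of two groups is realised on reduced words. \<open>fp_cons\<close> multiplies a
  reduced word by one (possibly trivial) letter from the left.\<close>

fun fp_cons :: "'g monoid \<Rightarrow> 'h monoid \<Rightarrow> 'g + 'h \<Rightarrow> ('g + 'h) list \<Rightarrow> ('g + 'h) list" where
  "fp_cons M N (Inl x) (Inl y # w) =
     (if x \<otimes>\<^bsub>M\<^esub> y = \<one>\<^bsub>M\<^esub> then w else Inl (x \<otimes>\<^bsub>M\<^esub> y) # w)"
| "fp_cons M N (Inr x) (Inr y # w) =
     (if x \<otimes>\<^bsub>N\<^esub> y = \<one>\<^bsub>N\<^esub> then w else Inr (x \<otimes>\<^bsub>N\<^esub> y) # w)"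
| "fp_cons M N (Inl x) w = (if x = \<one>\<^bsub>M\<^esub> then w else Inl x # w)"
| "fp_cons M N (Inr x) w = (if x = \<one>\<^bsub>N\<^esub> then w else Inr x # w)"

definition reduced_words :: "'g monoid \<Rightarrow> 'h monoid \<Rightarrow> ('g + 'h) list set" where
  "reduced_words M N =
    {w. set w \<subseteq> (carrier M - {\<one>\<^bsub>M\<^esub>}) <+> (carrier N - {\<one>\<^bsub>N\<^esub>}) \<and>
        successively (\<lambda>l l'. isl l \<noteq> isl l') w}"

definition free_product :: "'g monoid \<Rightarrow> 'h monoid \<Rightarrow> ('g + 'h) list monoid" where
  "free_product M N =
    \<lparr>carrier = reduced_words M N, mult = foldr (fp_cons M N), one = []\<rparr>"

definition fp_act ::
  "('o, 'm, 'g) crossed \<Rightarrow> ('o, 'm, 'h) crossed \<Rightarrow> ('g + 'h) list \<Rightarrow> 'm \<Rightarrow> 'm" where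
  "fp_act G H = foldr (case_sum (act G) (act H))"

text \<open>\<open>\<phi>\<^sup>*\<close> on words is forced by \<open>\<phi>\<^sup>*(xy) = (\<phi>\<^sup>y)\<^sup>*(x) \<phi>\<^sup>*(y)\<close>.\<close>

primrec fp_pull ::
  "('o, 'm) cat \<Rightarrow> ('o, 'm, 'g) crossed \<Rightarrow> ('o, 'm, 'h) crossed \<Rightarrow>
    'm \<Rightarrow> ('g + 'h) list \<Rightarrow> ('g + 'h) list" where
  "fp_pull A G H \<phi> [] = []"
| "fp_pull A G H \<phi> (l # w) =
     fp_cons (grp G (Dom A \<phi>)) (grp H (Dom A \<phi>))
       (map_sum (pull G (fp_act G H w \<phi>)) (pull H (fp_act G H w \<phi>)) l)
       (fp_pull A G H \<phi> w)"

definition coprod ::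
  "('o, 'm) cat \<Rightarrow> ('o, 'm, 'g) crossed \<Rightarrow> ('o, 'm, 'h) crossed \<Rightarrow> ('o, 'm, ('g + 'h) list) crossed"
  where
  "coprod A G H = \<lparr>grp = \<lambda>a. free_product (grp G a) (grp H a),
     pull = fp_pull A G H, act = fp_act G H\<rparr>"

definition inl :: "('o, 'm, 'g) crossed \<Rightarrow> 'o \<Rightarrow> 'g \<Rightarrow> ('g + 'h) list" where
  "inl G a x = (if x = \<one>\<^bsub>grp G a\<^esub> then [] else [Inl x])"

definition inr :: "('o, 'm, 'h) crossed \<Rightarrow> 'o \<Rightarrow> 'h \<Rightarrow> ('g + 'h) list" where
  "inr H a y = (if y = \<one>\<^bsub>grp H a\<^esub> then [] else [Inr y])"

definition copair ::
  "('o, 'm, 'k) crossed \<Rightarrow> ('o \<Rightarrow> 'g \<Rightarrow> 'k) \<Rightarrow> ('o \<Rightarrow> 'h \<Rightarrow> 'k) \<Rightarrow> 'o \<Rightarrow> ('g + 'h) list \<Rightarrow> 'k" where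
  "copair L u v a w =
    foldr (\<lambda>l y. case_sum (u a) (v a) l \<otimes>\<^bsub>grp L a\<^esub> y) w \<one>\<^bsub>grp L a\<^esub>"


section \<open>Epimorphisms\<close>

text \<open>A formula cannot quantify over all types, so test objects are taken with elements in
  the fixed type \<open>('h + 'h) list set\<close>, where \<open>'h\<close> is the element type of the codomain \<open>H\<close>. This is
  no restriction: two maps \<open>u, v : H \<rightarrow> L\<close> factor through the image of \<open>coprod A H H \<rightarrow> L\<close>, whose elements
  can be encoded by their fibres, which are sets of words. Lemma \<open>crossed_epi_cancel\<close> below
  proves the cancellation property for targets with elements in an arbitrary type.\<close>

definition crossed_epi ::
  "('o, 'm) cat \<Rightarrow> ('o, 'm, 'g) crossed \<Rightarrow> ('o, 'm, 'h) crossed \<Rightarrow> ('o \<Rightarrow> 'g \<Rightarrow> 'h) \<Rightarrow> bool" where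
  "crossed_epi A G H f \<longleftrightarrow> crossed_hom A G H f \<and>
    (\<forall>(L :: ('o, 'm, ('h + 'h) list set) crossed) u v.
       crossed_group A L \<and> crossed_hom A H L u \<and> crossed_hom A H L v \<and>
       (\<forall>a\<in>Obj A. \<forall>x\<in>elts G a. u a (f a x) = v a (f a x)) \<longrightarrow>
       (\<forall>a\<in>Obj A. \<forall>y\<in>elts H a. u a y = v a y))"


section \<open>Virtual products\<close>

definition commutator_subgroup :: "'g monoid \<Rightarrow> 'g set \<Rightarrow> 'g set \<Rightarrow> 'g set" where
  "commutator_subgroup M X Y =
    generate M (\<Union>x\<in>X. \<Union>y\<in>Y. {x \<otimes>\<^bsub>M\<^esub> y \<otimes>\<^bsub>M\<^esub> inv\<^bsub>M\<^esub> x \<otimes>\<^bsub>M\<^esub> inv\<^bsub>M\<^esub> y})"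

definition virtual_product ::
  "('o, 'm) cat \<Rightarrow> ('o, 'm, 'g) crossed \<Rightarrow> ('o \<Rightarrow> 'g set) \<Rightarrow> ('o \<Rightarrow> 'g set) \<Rightarrow> bool" where
  "virtual_product A G G1 G2 \<longleftrightarrow>
    crossed_epi A (coprod A (sub G G1) (sub G G2)) G (copair G (\<lambda>a x. x) (\<lambda>a y. y)) \<and>
    (\<forall>a\<in>Obj A. G1 a \<inter> G2 a = {\<one>\<^bsub>grp G a\<^esub>}) \<and>
    (\<forall>a\<in>Obj A. commutator_subgroup (grp G a) (G1 a) (G2 a) = {\<one>\<^bsub>grp G a\<^esub>})"


section \<open>Quotients\<close>

definition quot_grp :: "('o, 'm, 'g) crossed \<Rightarrow> ('o \<Rightarrow> 'g set) \<Rightarrow> 'o \<Rightarrow> 'g set monoid" where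
  "quot_grp H N a = grp H a Mod N a"

text \<open>The image \<open>\<phi>\<^sup>*(C)\<close> of a coset \<open>C\<close> is contained in a single coset, which is the product
  \<open>N(a) \<phi>\<^sup>*(C)\<close>; see lemma \<open>quot_pull_coset\<close>.\<close>

definition quot_pull ::
  "('o, 'm) cat \<Rightarrow> ('o, 'm, 'g) crossed \<Rightarrow> ('o \<Rightarrow> 'g set) \<Rightarrow> 'm \<Rightarrow> 'g set \<Rightarrow> 'g set" where
  "quot_pull A H N \<phi> C = N (Dom A \<phi>) <#>\<^bsub>grp H (Dom A \<phi>)\<^esub> (pull H \<phi> ` C)"


section \<open>The two sides of the correspondence\<close>

text \<open>The quintuples \<open>(K1, H1, K2, H2, \<chi>)\<close>, where \<open>K1\<close>, \<open>K2\<close> are the larger groups.\<close>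

definition goursat_data ::
  "('o, 'm) cat \<Rightarrow> ('o, 'm, 'g) crossed \<Rightarrow> ('o \<Rightarrow> 'g set) \<Rightarrow> ('o \<Rightarrow> 'g set) \<Rightarrow>
    (('o \<Rightarrow> 'g set) \<times> ('o \<Rightarrow> 'g set) \<times> ('o \<Rightarrow> 'g set) \<times> ('o \<Rightarrow> 'g set) \<times>
      ('o \<Rightarrow> 'g set \<Rightarrow> 'g set)) set" where
  "goursat_data A G G1 G2 = {(K1, H1, K2, H2, \<chi>).
     K1 \<in> crossed_subgroups A (sub G G1) \<and> H1 \<in> crossed_subgroups A (sub G K1) \<and>
     K2 \<in> crossed_subgroups A (sub G G2) \<and> H2 \<in> crossed_subgroups A (sub G K2) \<and>
     (\<forall>a\<in>Obj A. H1 a \<lhd> grp (sub G K1) a \<and> H2 a \<lhd> grp (sub G K2) a) \<and>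
     \<chi> \<in> extensional (Obj A) \<and>
     (\<forall>a\<in>Obj A. \<chi> a \<in> extensional (carrier (quot_grp (sub G K1) H1 a))) \<and>
     presheaf_map A
       (\<lambda>a. carrier (quot_grp (sub G K1) H1 a)) (quot_pull A (sub G K1) H1)
       (\<lambda>a. carrier (quot_grp (sub G K2) H2 a)) (quot_pull A (sub G K2) H2) \<chi> \<and>
     (\<forall>a\<in>Obj A. \<chi> a \<in> iso (quot_grp (sub G K1) H1 a) (quot_grp (sub G K2) H2 a))}"

text \<open>Goursat's construction: \<open>K1\<close>, \<open>K2\<close> are the projections of \<open>H\<close> to the two factors, \<open>H1\<close>, \<open>H2\<close>
  its intersections with them, and \<open>\<chi>\<close> sends the class of \<open>x\<close> to that of \<open>y\<close> whenever \<open>xy \<in> H\<close>.\<close>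

definition goursat ::
  "('o, 'm) cat \<Rightarrow> ('o, 'm, 'g) crossed \<Rightarrow> ('o \<Rightarrow> 'g set) \<Rightarrow> ('o \<Rightarrow> 'g set) \<Rightarrow> ('o \<Rightarrow> 'g set) \<Rightarrow>
    ('o \<Rightarrow> 'g set) \<times> ('o \<Rightarrow> 'g set) \<times> ('o \<Rightarrow> 'g set) \<times> ('o \<Rightarrow> 'g set) \<times>
      ('o \<Rightarrow> 'g set \<Rightarrow> 'g set)" where
  "goursat A G G1 G2 H =
    (let K1 = (\<lambda>a\<in>Obj A. {x \<in> G1 a. \<exists>y\<in>G2 a. x \<otimes>\<^bsub>grp G a\<^esub> y \<in> H a});
         H1 = (\<lambda>a\<in>Obj A. H a \<inter> G1 a);
         K2 = (\<lambda>a\<in>Obj A. {y \<in> G2 a. \<exists>x\<in>G1 a. x \<otimes>\<^bsub>grp G a\<^esub> y \<in> H a});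
         H2 = (\<lambda>a\<in>Obj A. H a \<inter> G2 a);
         \<chi> = (\<lambda>a\<in>Obj A. \<lambda>C\<in>carrier (quot_grp (sub G K1) H1 a).
                {y \<in> G2 a. \<exists>x\<in>C. x \<otimes>\<^bsub>grp G a\<^esub> y \<in> H a})
     in (K1, H1, K2, H2, \<chi>))"


section \<open>The definitions behave as intended\<close>

subsection \<open>Crossed groups and their subgroups\<close>

lemma (in small_category) Hom_Obj:
  assumes "\<phi> \<in> Hom A a b" shows "a \<in> Obj A" "b \<in> Obj A"
  using assms Dom_Obj Cod_Obj by (auto simp: Hom_def)

lemma Hom_Dom: "\<phi> \<in> Hom A a b \<Longrightarrow> Dom A \<phi> = a" and Hom_Cod: "\<phi> \<in> Hom A a b \<Longrightarrow> Cod A \<phi> = b"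
  by (auto simp: Hom_def)

lemma group_action_restrict_iff:
  assumes "group M"
  shows "group_action M E (\<lambda>x. \<lambda>e\<in>E. f x e) \<longleftrightarrow>
    (\<forall>x\<in>carrier M. \<forall>e\<in>E. f x e \<in> E) \<and> (\<forall>e\<in>E. f \<one>\<^bsub>M\<^esub> e = e) \<and>
    (\<forall>x\<in>carrier M. \<forall>y\<in>carrier M. \<forall>e\<in>E. f (x \<otimes>\<^bsub>M\<^esub> y) e = f x (f y e))" (is "?l \<longleftrightarrow> ?r")
proof
  assume ?l
  then interpret group_action M E "\<lambda>x. \<lambda>e\<in>E. f x e" .
  have c: "f x e \<in> E" if "x \<in> carrier M" "e \<in> E" for x e
    using element_image[OF that refl] that by simp
  have "f \<one>\<^bsub>M\<^esub> e = e" if "e \<in> E" for e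
    using id_eq_one that by (metis restrict_apply')
  moreover have "f (x \<otimes>\<^bsub>M\<^esub> y) e = f x (f y e)"
    if "x \<in> carrier M" "y \<in> carrier M" "e \<in> E" for x y e
    using composition_rule[OF that(3,1,2)] that c by simp
  ultimately show ?r using c by blast
next
  interpret group M by fact
  assume r: ?r
  have bij: "(\<lambda>e\<in>E. f x e) \<in> Bij E" if x: "x \<in> carrier M" for x
  proof -
    have "bij_betw (\<lambda>e\<in>E. f x e) E E"
    proof (rule bij_betw_byWitness[where f' = "\<lambda>e\<in>E. f (inv\<^bsub>M\<^esub> x) e"])
      show "\<forall>e\<in>E. (\<lambda>e\<in>E. f (inv\<^bsub>M\<^esub> x) e) ((\<lambda>e\<in>E. f x e) e) = e"
        using r x by (metis inv_closed l_inv restrict_apply')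
      show "\<forall>e\<in>E. (\<lambda>e\<in>E. f x e) ((\<lambda>e\<in>E. f (inv\<^bsub>M\<^esub> x) e) e) = e"
        using r x by (metis inv_closed r_inv restrict_apply')
    qed (use r x in auto)
    then show ?thesis by (simp add: Bij_def)
  qed
  show ?l
  proof (intro group_action.intro group_hom.intro group_hom_axioms.intro homI)
    show "group M" by fact
    show "group (BijGroup E)" by (rule group_BijGroup)
  next
    fix x y assume xy: "x \<in> carrier M" "y \<in> carrier M"
    show "(\<lambda>e\<in>E. f x e) \<in> carrier (BijGroup E)" using bij xy by (simp add: BijGroup_def)
    show "(\<lambda>e\<in>E. f (x \<otimes>\<^bsub>M\<^esub> y) e) = (\<lambda>e\<in>E. f x e) \<otimes>\<^bsub>BijGroup E\<^esub> (\<lambda>e\<in>E. f y e)"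
      using r xy bij by (auto simp: BijGroup_def compose_def)
  qed
qed

context crossed_group
begin

lemma act_closed: "\<phi> \<in> Hom A a b \<Longrightarrow> x \<in> elts G b \<Longrightarrow> act G x \<phi> \<in> Hom A a b"
  and act_one: "\<phi> \<in> Hom A a b \<Longrightarrow> act G \<one>\<^bsub>grp G b\<^esub> \<phi> = \<phi>"
  and act_mult: "\<phi> \<in> Hom A a b \<Longrightarrow> x \<in> elts G b \<Longrightarrow> y \<in> elts G b \<Longrightarrow>
    act G (x \<otimes>\<^bsub>grp G b\<^esub> y) \<phi> = act G x (act G y \<phi>)"
  using action[of a b] group_action_restrict_iff[OF grp, of b "Hom A a b" "act G"] Hom_Obj
  by blast+

lemma pull_one:
  assumes "\<phi> \<in> Hom A a b" shows "pull G \<phi> \<one>\<^bsub>grp G b\<^esub> = \<one>\<^bsub>grp G a\<^esub>"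
proof -
  interpret Ga: group "grp G a" using grp Hom_Obj assms by blast
  interpret Gb: group "grp G b" using grp Hom_Obj assms by blast
  have "pull G \<phi> \<one>\<^bsub>grp G b\<^esub> = pull G \<phi> \<one>\<^bsub>grp G b\<^esub> \<otimes>\<^bsub>grp G a\<^esub> pull G \<phi> \<one>\<^bsub>grp G b\<^esub>"
    using pull_mult[OF assms Gb.one_closed Gb.one_closed] act_one[OF assms] by simp
  then show ?thesis using p_closed[OF assms Gb.one_closed] by (metis Ga.r_cancel_one')
qed

end

lemma (in small_category) crossed_groupI:
  fixes G :: "('o, 'm, 'g) crossed"
  assumes "\<And>a b \<phi> x. \<phi> \<in> Hom A a b \<Longrightarrow> x \<in> elts G b \<Longrightarrow> pull G \<phi> x \<in> elts G a"
    and "\<And>a x. a \<in> Obj A \<Longrightarrow> x \<in> elts G a \<Longrightarrow> pull G (Ident A a) x = x"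
    and "\<And>a b c \<phi> \<psi> x. \<phi> \<in> Hom A a b \<Longrightarrow> \<psi> \<in> Hom A b c \<Longrightarrow> x \<in> elts G c \<Longrightarrow>
      pull G (Comp A \<psi> \<phi>) x = pull G \<phi> (pull G \<psi> x)"
    and g: "\<And>a. a \<in> Obj A \<Longrightarrow> group (grp G a)"
    and a: "\<And>a b \<phi> x. \<phi> \<in> Hom A a b \<Longrightarrow> x \<in> elts G b \<Longrightarrow> act G x \<phi> \<in> Hom A a b"
      "\<And>a b \<phi>. \<phi> \<in> Hom A a b \<Longrightarrow> act G \<one>\<^bsub>grp G b\<^esub> \<phi> = \<phi>"
      "\<And>a b \<phi> x y. \<phi> \<in> Hom A a b \<Longrightarrow> x \<in> elts G b \<Longrightarrow> y \<in> elts G b \<Longrightarrow>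
        act G (x \<otimes>\<^bsub>grp G b\<^esub> y) \<phi> = act G x (act G y \<phi>)"
    and "\<And>a b c \<phi> \<psi> x. \<phi> \<in> Hom A a b \<Longrightarrow> \<psi> \<in> Hom A b c \<Longrightarrow> x \<in> elts G c \<Longrightarrow>
      act G x (Comp A \<psi> \<phi>) = Comp A (act G x \<psi>) (act G (pull G \<psi> x) \<phi>)"
    and "\<And>a b \<phi> x y. \<phi> \<in> Hom A a b \<Longrightarrow> x \<in> elts G b \<Longrightarrow> y \<in> elts G b \<Longrightarrow>
      pull G \<phi> (x \<otimes>\<^bsub>grp G b\<^esub> y) = pull G (act G y \<phi>) x \<otimes>\<^bsub>grp G a\<^esub> pull G \<phi> y"
  shows "crossed_group A G"
proof (intro crossed_group.intro crossed_group_axioms.intro presheaf.intro presheaf_axioms.intro)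
  show "small_category A" by unfold_locales
  fix a b assume "a \<in> Obj A" "b \<in> Obj A"
  then show "group_action (grp G b) (Hom A a b) (\<lambda>x. \<lambda>\<phi>\<in>Hom A a b. act G x \<phi>)"
    using group_action_restrict_iff[OF g, of b "Hom A a b" "act G"] a by auto
qed (fact assms)+

lemma crossed_group_sub:
  assumes "crossed_group A G" "crossed_subgroup A G K"
  shows "crossed_group A (sub G K)"
proof -
  interpret crossed_group A G by fact
  have sg: "subgroup (K a) (grp G a)" if "a \<in> Obj A" for a
    using assms(2) that by (simp add: crossed_subgroup_def)
  have K: "x \<in> elts G b" if "x \<in> K b" "b \<in> Obj A" for x b
    using subgroup.subset[OF sg[OF that(2)]] that(1) by blast
  have K': "x \<in> elts G b" if "x \<in> K b" "\<phi> \<in> Hom A a b" for x a b \<phi>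
    using K that Hom_Obj by blast
  show ?thesis
  proof (rule crossed_groupI)
    show "group (grp (sub G K) a)" if "a \<in> Obj A" for a
      using group.subgroup_imp_group[OF grp[OF that] sg[OF that]] by (simp add: sub_def)
    show "pull (sub G K) \<phi> x \<in> elts (sub G K) a"
      if "\<phi> \<in> Hom A a b" "x \<in> elts (sub G K) b" for a b \<phi> x
      using that assms(2) Hom_Obj[OF that(1)] by (simp add: crossed_subgroup_def sub_def)
  qed (simp_all add: sub_def act_one p_Ident[OF _ K] p_Comp[OF _ _ K'] act_closed[OF _ K']
      act_mult[OF _ K' K'] act_Comp[OF _ _ K'] pull_mult[OF _ K' K'])
qed

lemma crossed_hom_sub_inclusion:
  assumes "crossed_group A G" "crossed_subgroup A G K"
  shows "crossed_hom A (sub G K) G (\<lambda>a x. x)"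
proof -
  interpret crossed_group A G by fact
  have "K a \<subseteq> elts G a" if "a \<in> Obj A" for a
    using assms(2) that subgroup.subset by (auto simp: crossed_subgroup_def)
  then show ?thesis
    by (auto simp: crossed_hom_def sub_def presheaf_map_def hom_def)
qed

lemma crossed_homD:
  assumes "crossed_hom A G H f"
  shows "a \<in> Obj A \<Longrightarrow> f a \<in> hom (grp G a) (grp H a)"
    and "a \<in> Obj A \<Longrightarrow> x \<in> elts G a \<Longrightarrow> f a x \<in> elts H a"
    and "a \<in> Obj A \<Longrightarrow> x \<in> elts G a \<Longrightarrow> y \<in> elts G a \<Longrightarrow>
      f a (x \<otimes>\<^bsub>grp G a\<^esub> y) = f a x \<otimes>\<^bsub>grp H a\<^esub> f a y"
    and "small_category A \<Longrightarrow> \<phi> \<in> Hom A a b \<Longrightarrow> x \<in> elts G b \<Longrightarrow>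
      f a (pull G \<phi> x) = pull H \<phi> (f b x)"
    and "small_category A \<Longrightarrow> \<phi> \<in> Hom A a b \<Longrightarrow> x \<in> elts G b \<Longrightarrow> act H (f b x) \<phi> = act G x \<phi>"
  using assms small_category.Hom_Obj[of A \<phi> a b]
  by (auto simp: crossed_hom_def presheaf_map_def hom_def)


subsection \<open>The coproduct\<close>

definition letters :: "'g monoid \<Rightarrow> 'h monoid \<Rightarrow> ('g + 'h) set" where
  "letters M N = carrier M <+> carrier N"

text \<open>Folding an action of letters over a word is compatible with reduction.\<close>

locale letter_action = M: group M + N: group N
  for M :: "'g monoid" and N :: "'h monoid" +
  fixes E :: "'e set" and f :: "'g + 'h \<Rightarrow> 'e \<Rightarrow> 'e"
  assumes closed: "l \<in> letters M N \<Longrightarrow> e \<in> E \<Longrightarrow> f l e \<in> E"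
    and oneL: "e \<in> E \<Longrightarrow> f (Inl \<one>\<^bsub>M\<^esub>) e = e"
    and oneR: "e \<in> E \<Longrightarrow> f (Inr \<one>\<^bsub>N\<^esub>) e = e"
    and multL: "x \<in> carrier M \<Longrightarrow> y \<in> carrier M \<Longrightarrow> e \<in> E \<Longrightarrow>
      f (Inl x) (f (Inl y) e) = f (Inl (x \<otimes>\<^bsub>M\<^esub> y)) e"
    and multR: "x' \<in> carrier N \<Longrightarrow> y' \<in> carrier N \<Longrightarrow> e \<in> E \<Longrightarrow>
      f (Inr x') (f (Inr y') e) = f (Inr (x' \<otimes>\<^bsub>N\<^esub> y')) e"
begin

lemma foldr_closed: "set w \<subseteq> letters M N \<Longrightarrow> e \<in> E \<Longrightarrow> foldr f w e \<in> E"
  by (induction w) (auto simp: closed)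

lemma foldr_fp_cons:
  assumes "l \<in> letters M N" "set w \<subseteq> letters M N" "e \<in> E"
  shows "foldr f (fp_cons M N l w) e = f l (foldr f w e)"
  using assms
proof (cases "(M, N, l, w)" rule: fp_cons.cases)
  case (1 M' N' x y w')
  then have "x \<in> carrier M" "y \<in> carrier M" "foldr f w' e \<in> E"
    using assms foldr_closed by (auto simp: letters_def)
  with 1 oneL[of "foldr f w' e"] show ?thesis by (auto simp: multL)
next
  case (2 M' N' x y w')
  then have "x \<in> carrier N" "y \<in> carrier N" "foldr f w' e \<in> E"
    using assms foldr_closed by (auto simp: letters_def)
  with 2 oneR[of "foldr f w' e"] show ?thesis by (auto simp: multR)
qed (use foldr_closed[OF assms(2,3)] in \<open>auto simp: oneL oneR\<close>)

lemma fp_cons_letters: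
  "l \<in> letters M N \<Longrightarrow> set w \<subseteq> letters M N \<Longrightarrow> set (fp_cons M N l w) \<subseteq> letters M N"
  by (cases "(M, N, l, w)" rule: fp_cons.cases) (auto simp: letters_def)

lemma foldr_mult:
  assumes "set v \<subseteq> letters M N" "e \<in> E"
  shows "set u \<subseteq> letters M N \<Longrightarrow>
    set (foldr (fp_cons M N) u v) \<subseteq> letters M N \<and>
    foldr f (foldr (fp_cons M N) u v) e = foldr f u (foldr f v e)"
proof (induction u)
  case (Cons l u)
  then show ?case using assms(2) by (simp add: foldr_fp_cons fp_cons_letters)
qed (use assms in simp)

end

lemma reduced_words_letters: "w \<in> reduced_words M N \<Longrightarrow> set w \<subseteq> letters M N"
  by (auto simp: reduced_words_def letters_def)

lemma reduced_words_Nil: "[] \<in> reduced_words M N"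
  by (simp add: reduced_words_def)

lemma reduced_words_Cons:
  "l # w \<in> reduced_words M N \<longleftrightarrow> w \<in> reduced_words M N \<and> l \<in> letters M N \<and>
     l \<noteq> Inl \<one>\<^bsub>M\<^esub> \<and> l \<noteq> Inr \<one>\<^bsub>N\<^esub> \<and> (w \<noteq> [] \<longrightarrow> isl l \<noteq> isl (hd w))"
  by (cases w; cases l) (auto simp: reduced_words_def letters_def)

lemma fp_cons_reduced:
  assumes "group M" "group N" "l \<in> letters M N" "w \<in> reduced_words M N"
  shows "fp_cons M N l w \<in> reduced_words M N"
proof -
  interpret M: group M by fact
  interpret N: group N by fact
  show ?thesis using assms(3,4)
    by (cases "(M, N, l, w)" rule: fp_cons.cases)
      (auto simp: reduced_words_Cons letters_def reduced_words_Nil)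
qed

lemma fp_cons_mult:
  assumes "group M" "group N" "w \<in> reduced_words M N"
  shows "x \<in> carrier M \<Longrightarrow> y \<in> carrier M \<Longrightarrow>
      fp_cons M N (Inl x) (fp_cons M N (Inl y) w) = fp_cons M N (Inl (x \<otimes>\<^bsub>M\<^esub> y)) w"
    and "x' \<in> carrier N \<Longrightarrow> y' \<in> carrier N \<Longrightarrow>
      fp_cons M N (Inr x') (fp_cons M N (Inr y') w) = fp_cons M N (Inr (x' \<otimes>\<^bsub>N\<^esub> y')) w"
proof -
  interpret M: group M by fact
  interpret N: group N by fact
  { assume xy: "x \<in> carrier M" "y \<in> carrier M"
    show "fp_cons M N (Inl x) (fp_cons M N (Inl y) w) = fp_cons M N (Inl (x \<otimes>\<^bsub>M\<^esub> y)) w"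
    proof (cases w)
      case (Cons l v)
      show ?thesis
      proof (cases l)
        case (Inl z)
        with Cons assms(3) have z: "z \<in> carrier M" "z \<noteq> \<one>\<^bsub>M\<^esub>" and v: "v = [] \<or> \<not> isl (hd v)"
          by (auto simp: reduced_words_Cons letters_def)
        have *: "x \<otimes>\<^bsub>M\<^esub> y \<otimes>\<^bsub>M\<^esub> z = x" if "y \<otimes>\<^bsub>M\<^esub> z = \<one>\<^bsub>M\<^esub>"
          using that xy z by (simp add: M.m_assoc)
        have vv: "fp_cons M N (Inl x) v = (if x = \<one>\<^bsub>M\<^esub> then v else Inl x # v)"
          using v by (cases v; cases "hd v") auto
        show ?thesis using * xy z vv by (auto simp: Cons Inl M.m_assoc)
      qed (use Cons xy in auto)
    qed (use xy in auto) }
  { assume xy: "x' \<in> carrier N" "y' \<in> carrier N"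
    show "fp_cons M N (Inr x') (fp_cons M N (Inr y') w) = fp_cons M N (Inr (x' \<otimes>\<^bsub>N\<^esub> y')) w"
    proof (cases w)
      case (Cons l v)
      show ?thesis
      proof (cases l)
        case (Inr z)
        with Cons assms(3) have z: "z \<in> carrier N" "z \<noteq> \<one>\<^bsub>N\<^esub>" and v: "v = [] \<or> isl (hd v)"
          by (auto simp: reduced_words_Cons letters_def)
        have *: "x' \<otimes>\<^bsub>N\<^esub> y' \<otimes>\<^bsub>N\<^esub> z = x'" if "y' \<otimes>\<^bsub>N\<^esub> z = \<one>\<^bsub>N\<^esub>"
          using that xy z by (simp add: N.m_assoc)
        have vv: "fp_cons M N (Inr x') v = (if x' = \<one>\<^bsub>N\<^esub> then v else Inr x' # v)"
          using v by (cases v; cases "hd v") auto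
        show ?thesis using * xy z vv by (auto simp: Cons Inr N.m_assoc)
      qed (use Cons xy in auto)
    qed (use xy in auto) }
qed

lemma fp_cons_one:
  assumes "group M" "group N" "w \<in> reduced_words M N"
  shows "fp_cons M N (Inl \<one>\<^bsub>M\<^esub>) w = w" "fp_cons M N (Inr \<one>\<^bsub>N\<^esub>) w = w"
proof -
  interpret M: group M by fact
  interpret N: group N by fact
  show "fp_cons M N (Inl \<one>\<^bsub>M\<^esub>) w = w" "fp_cons M N (Inr \<one>\<^bsub>N\<^esub>) w = w"
    using assms(3) by (cases w; cases "hd w"; auto simp: reduced_words_Cons letters_def)+
qed

lemma letter_action_fp_cons:
  assumes "group M" "group N"
  shows "letter_action M N (reduced_words M N) (fp_cons M N)"
  using assms
  by (intro letter_action.intro letter_action_axioms.intro)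
    (auto simp: fp_cons_reduced fp_cons_mult fp_cons_one)

lemma fp_cons_reduced_Cons: "l # w \<in> reduced_words M N \<Longrightarrow> fp_cons M N l w = l # w"
  by (cases "(M, N, l, w)" rule: fp_cons.cases) (auto simp: reduced_words_Cons)

lemma foldr_fp_cons_Nil: "w \<in> reduced_words M N \<Longrightarrow> foldr (fp_cons M N) w [] = w"
  by (induction w) (auto simp: fp_cons_reduced_Cons, auto simp: reduced_words_Cons fp_cons_reduced_Cons)

lemma group_free_product:
  assumes "group M" "group N"
  shows "group (free_product M N)"
proof -
  interpret letter_action M N "reduced_words M N" "fp_cons M N"
    by (rule letter_action_fp_cons) fact+
  show ?thesis
  proof (rule groupI)
    fix x assume "x \<in> carrier (free_product M N)"
    then have "x \<in> reduced_words M N" by (simp add: free_product_def)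
    then have "\<exists>y\<in>reduced_words M N. foldr (fp_cons M N) y x = []"
    proof (induction x)
      case (Cons l w)
      then obtain y where y: "y \<in> reduced_words M N" "foldr (fp_cons M N) y w = []"
        and l: "l \<in> letters M N" and w: "w \<in> reduced_words M N"
        by (auto simp: reduced_words_Cons)
      define l' where "l' = map_sum (\<lambda>x. inv\<^bsub>M\<^esub> x) (\<lambda>x. inv\<^bsub>N\<^esub> x) l"
      have l': "l' \<in> letters M N" using l by (auto simp: l'_def letters_def)
      have c: "fp_cons M N l' (l # w) = w"
        using l by (auto simp: l'_def letters_def)
      let ?y = "foldr (fp_cons M N) y (fp_cons M N l' [])"
      have "?y \<in> reduced_words M N"
        using y l' by (intro foldr_closed fp_cons_reduced reduced_words_letters)
          (auto simp: assms reduced_words_Nil)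
      moreover have "foldr (fp_cons M N) ?y (l # w) = foldr (fp_cons M N) y (foldr (fp_cons M N) (fp_cons M N l' []) (l # w))"
        using y l' Cons.prems
        by (intro foldr_mult[THEN conjunct2] reduced_words_letters fp_cons_reduced)
          (auto simp: assms reduced_words_Nil)
      moreover have "foldr (fp_cons M N) (fp_cons M N l' []) (l # w) = w"
        using foldr_fp_cons[OF l' _ Cons.prems, of "[]"] c by simp
      ultimately show ?case using y(2) by metis
    qed (auto intro: bexI[OF _ reduced_words_Nil])
    then show "\<exists>y\<in>carrier (free_product M N). y \<otimes>\<^bsub>free_product M N\<^esub> x = \<one>\<^bsub>free_product M N\<^esub>"
      by (simp add: free_product_def)
  qed (auto simp: free_product_def reduced_words_Nil
      foldr_closed reduced_words_letters foldr_mult[THEN conjunct2])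
qed

lemma (in crossed_group) act_Ident:
  assumes "a \<in> Obj A" "x \<in> elts G a" shows "act G x (Ident A a) = Ident A a"
proof -
  interpret group "grp G a" using grp assms by blast
  have I: "Ident A a \<in> Hom A a a" using Ident_Hom assms by blast
  define \<phi> where "\<phi> = act G (inv\<^bsub>grp G a\<^esub> x) (Ident A a)"
  have \<phi>: "\<phi> \<in> Hom A a a" and x\<phi>: "act G x \<phi> = Ident A a"
    using act_closed[OF I] act_mult[OF I, of x "inv\<^bsub>grp G a\<^esub> x"] act_one[OF I] assms
    by (auto simp: \<phi>_def)
  have "act G x (Comp A (Ident A a) \<phi>) = Comp A (act G x (Ident A a)) (act G x \<phi>)"
    using act_Comp[OF \<phi> I] p_Ident assms by simp
  then show ?thesis
    using x\<phi> Comp_Ident_left[OF \<phi>] Comp_Ident_right[OF act_closed[OF I assms(2)]] by simp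
qed

locale two_crossed_groups = G: crossed_group A G + H: crossed_group A H
  for A :: "('o, 'm) cat" and G :: "('o, 'm, 'g) crossed" and H :: "('o, 'm, 'h) crossed"
begin

abbreviation "lts a \<equiv> letters (grp G a) (grp H a)"
abbreviation "rw a \<equiv> reduced_words (grp G a) (grp H a)"
abbreviation "cons a \<equiv> fp_cons (grp G a) (grp H a)"
abbreviation "lact \<equiv> case_sum (act G) (act H)"
abbreviation "lpull \<phi> \<equiv> map_sum (pull G \<phi>) (pull H \<phi>)"

lemmas HomO = G.Hom_Obj

lemma lpull_closed: "\<phi> \<in> Hom A a b \<Longrightarrow> l \<in> lts b \<Longrightarrow> lpull \<phi> l \<in> lts a"
  using G.p_closed H.p_closed by (force simp: letters_def)

lemma lact_closed: "\<phi> \<in> Hom A a b \<Longrightarrow> l \<in> lts b \<Longrightarrow> lact l \<phi> \<in> Hom A a b"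
  using G.act_closed H.act_closed by (force simp: letters_def)

lemma la_cons: "a \<in> Obj A \<Longrightarrow> letter_action (grp G a) (grp H a) (rw a) (cons a)"
  by (intro letter_action_fp_cons G.grp H.grp)

lemma la_act:
  assumes "a \<in> Obj A" "b \<in> Obj A"
  shows "letter_action (grp G b) (grp H b) (Hom A a b) lact"
  using assms
  by (intro letter_action.intro letter_action_axioms.intro G.grp H.grp)
    (auto simp: lact_closed G.act_one H.act_one G.act_mult H.act_mult)

lemma fp_act_closed:
  assumes "\<phi> \<in> Hom A a b" "set w \<subseteq> lts b" shows "fp_act G H w \<phi> \<in> Hom A a b"
  unfolding fp_act_def using letter_action.foldr_closed[OF la_act assms(2,1)] HomO assms by blast

lemma fp_act_cons:
  assumes "\<phi> \<in> Hom A a b" "set w \<subseteq> lts b" "l \<in> lts b"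
  shows "fp_act G H (cons b l w) \<phi> = lact l (fp_act G H w \<phi>)"
  unfolding fp_act_def
  using letter_action.foldr_fp_cons[OF la_act assms(3,2,1)] HomO assms by blast

lemma fp_act_mult:
  assumes "\<phi> \<in> Hom A a b" "set w \<subseteq> lts b" "set v \<subseteq> lts b"
  shows "fp_act G H (foldr (cons b) v w) \<phi> = fp_act G H v (fp_act G H w \<phi>)"
  unfolding fp_act_def
  using letter_action.foldr_mult[OF la_act assms(2,1,3)] HomO assms by blast

definition tw :: "'o \<Rightarrow> 'g + 'h \<Rightarrow> 'm \<times> ('g + 'h) list \<Rightarrow> 'm \<times> ('g + 'h) list" where
  "tw a l s = (lact l (fst s), cons a (lpull (fst s) l) (snd s))"

lemma la_tw:
  assumes "a \<in> Obj A" "b \<in> Obj A"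
  shows "letter_action (grp G b) (grp H b) (Hom A a b \<times> rw a) (tw a)"
proof (intro letter_action.intro letter_action_axioms.intro G.grp H.grp)
  show "tw a l s \<in> Hom A a b \<times> rw a" if "l \<in> lts b" "s \<in> Hom A a b \<times> rw a" for l s
    using that assms
    by (auto simp: tw_def lact_closed intro!: fp_cons_reduced lpull_closed G.grp H.grp)
qed (use assms in \<open>auto simp: tw_def G.act_one H.act_one G.act_mult H.act_mult G.pull_one H.pull_one
    fp_cons_one G.grp H.grp G.pull_mult H.pull_mult
    intro!: fp_cons_mult G.p_closed H.p_closed G.act_closed H.act_closed\<close>)

lemma foldr_tw_Nil:
  assumes "\<phi> \<in> Hom A a b" "set w \<subseteq> lts b"
  shows "foldr (tw a) w (\<phi>, []) = (fp_act G H w \<phi>, fp_pull A G H \<phi> w)"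
  using assms(2)
proof (induction w)
  case (Cons l w)
  then have "Dom A \<phi> = a" using assms Hom_Dom by metis
  with Cons show ?case by (simp add: tw_def fp_act_def)
qed (simp add: fp_act_def)

lemma fp_pull_closed:
  assumes "\<phi> \<in> Hom A a b" "set w \<subseteq> lts b" shows "fp_pull A G H \<phi> w \<in> rw a"
  using letter_action.foldr_closed[OF la_tw assms(2), of a "(\<phi>, [])"] HomO[OF assms(1)] assms
  by (simp add: foldr_tw_Nil reduced_words_Nil)

lemma fp_pull_cons:
  assumes "\<phi> \<in> Hom A a b" "set w \<subseteq> lts b" "l \<in> lts b"
  shows "fp_pull A G H \<phi> (cons b l w) =
    cons a (lpull (fp_act G H w \<phi>) l) (fp_pull A G H \<phi> w)"
proof -
  have c: "set (cons b l w) \<subseteq> lts b"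
    using letter_action.fp_cons_letters[OF la_cons assms(3,2)] HomO assms by blast
  show ?thesis
    using letter_action.foldr_fp_cons[OF la_tw assms(3,2), of a "(\<phi>, [])"] HomO[OF assms(1)] assms c
    by (simp add: foldr_tw_Nil reduced_words_Nil tw_def)
qed

lemma foldr_tw:
  assumes "\<phi> \<in> Hom A a b" "set w \<subseteq> lts b" "e \<in> rw a"
  shows "foldr (tw a) w (\<phi>, e) = (fp_act G H w \<phi>, foldr (cons a) (fp_pull A G H \<phi> w) e)"
  using assms(2)
proof (induction w)
  case (Cons l w)
  then have w: "set w \<subseteq> lts b" and l: "l \<in> lts b" by auto
  have "Dom A \<phi> = a" by (rule Hom_Dom[OF assms(1)])
  moreover have "set (fp_pull A G H \<phi> w) \<subseteq> lts a"
    by (rule reduced_words_letters[OF fp_pull_closed[OF assms(1) w]])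
  moreover have "lpull (fp_act G H w \<phi>) l \<in> lts a"
    by (rule lpull_closed[OF fp_act_closed[OF assms(1) w] l])
  ultimately show ?case
    using Cons.IH[OF w] letter_action.foldr_fp_cons[OF la_cons, of a _ _ e] HomO[OF assms(1)] assms
    by (simp add: tw_def fp_act_def)
qed (simp add: fp_act_def)

lemma fp_pull_mult:
  assumes "\<phi> \<in> Hom A a b" "u \<in> rw b" "v \<in> rw b"
  shows "fp_pull A G H \<phi> (foldr (cons b) u v) =
    foldr (cons a) (fp_pull A G H (fp_act G H v \<phi>) u) (fp_pull A G H \<phi> v)"
proof -
  note O = HomO[OF assms(1)]
  have uv: "set u \<subseteq> lts b" "set v \<subseteq> lts b" using assms reduced_words_letters by blast+
  have m: "set (foldr (cons b) u v) \<subseteq> lts b"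
    "foldr (tw a) (foldr (cons b) u v) (\<phi>, []) = foldr (tw a) u (foldr (tw a) v (\<phi>, []))"
    using letter_action.foldr_mult[OF la_tw, of a b v "(\<phi>, [])" u] O uv assms
    by (auto simp: reduced_words_Nil)
  show ?thesis
    using m foldr_tw_Nil[OF assms(1) m(1)] foldr_tw_Nil[OF assms(1) uv(2)]
      foldr_tw[OF fp_act_closed[OF assms(1) uv(2)] uv(1) fp_pull_closed[OF assms(1) uv(2)]]
    by simp
qed

lemma fp_act_Ident: "a \<in> Obj A \<Longrightarrow> set w \<subseteq> lts a \<Longrightarrow> fp_act G H w (Ident A a) = Ident A a"
  by (induction w) (auto simp: fp_act_def letters_def G.act_Ident H.act_Ident)

lemma fp_pull_Ident:
  assumes "a \<in> Obj A" "w \<in> rw a" shows "fp_pull A G H (Ident A a) w = w"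
  using assms(2)
proof (induction w)
  case (Cons l w)
  then have w: "w \<in> rw a" "l \<in> lts a" by (auto simp: reduced_words_Cons)
  then have "lpull (Ident A a) l = l"
    using assms(1) by (auto simp: letters_def G.p_Ident H.p_Ident)
  then show ?case
    using Cons w fp_act_Ident[OF assms(1) reduced_words_letters[OF w(1)]]
      Hom_Dom[OF G.Ident_Hom[OF assms(1)]] fp_cons_reduced_Cons[OF Cons.prems]
    by simp
qed simp

lemma fp_Comp:
  assumes \<phi>: "\<phi> \<in> Hom A a b" and \<psi>: "\<psi> \<in> Hom A b c"
  shows "set w \<subseteq> lts c \<Longrightarrow>
    fp_act G H w (Comp A \<psi> \<phi>) = Comp A (fp_act G H w \<psi>) (fp_act G H (fp_pull A G H \<psi> w) \<phi>) \<and>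
    fp_pull A G H (Comp A \<psi> \<phi>) w = fp_pull A G H \<phi> (fp_pull A G H \<psi> w)"
proof (induction w)
  case (Cons l w)
  then have l: "l \<in> lts c" and w: "set w \<subseteq> lts c" by auto
  define \<psi>w where "\<psi>w = fp_act G H w \<psi>"
  define pw where "pw = fp_pull A G H \<psi> w"
  define \<phi>w where "\<phi>w = fp_act G H pw \<phi>"
  have \<psi>w: "\<psi>w \<in> Hom A b c" unfolding \<psi>w_def by (rule fp_act_closed[OF \<psi> w])
  have pw: "set pw \<subseteq> lts b"
    unfolding pw_def using fp_pull_closed[OF \<psi> w] reduced_words_letters by blast
  have \<phi>w: "\<phi>w \<in> Hom A a b" unfolding \<phi>w_def by (rule fp_act_closed[OF \<phi> pw])
  have l': "lpull \<psi>w l \<in> lts b" by (rule lpull_closed[OF \<psi>w l])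
  have IH: "fp_act G H w (Comp A \<psi> \<phi>) = Comp A \<psi>w \<phi>w"
    "fp_pull A G H (Comp A \<psi> \<phi>) w = fp_pull A G H \<phi> pw"
    using Cons.IH[OF w] by (auto simp: \<psi>w_def \<phi>w_def pw_def)
  have D: "Dom A (Comp A \<psi> \<phi>) = a" "Dom A \<psi> = b"
    using Hom_Dom[OF G.Comp_Hom[OF \<phi> \<psi>]] Hom_Dom[OF \<psi>] by auto
  have pl: "fp_pull A G H \<psi> (l # w) = cons b (lpull \<psi>w l) pw"
    using D by (simp add: \<psi>w_def pw_def)
  have "lact l (Comp A \<psi>w \<phi>w) = Comp A (lact l \<psi>w) (lact (lpull \<psi>w l) \<phi>w)"
    using l by (auto simp: letters_def G.act_Comp[OF \<phi>w \<psi>w] H.act_Comp[OF \<phi>w \<psi>w])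
  moreover have "lpull (Comp A \<psi>w \<phi>w) l = lpull \<phi>w (lpull \<psi>w l)"
    using l by (auto simp: letters_def G.p_Comp[OF \<phi>w \<psi>w] H.p_Comp[OF \<phi>w \<psi>w])
  moreover have "fp_act G H (l # w) \<theta> = lact l (fp_act G H w \<theta>)" for \<theta>
    by (simp add: fp_act_def)
  ultimately show ?case
    unfolding pl fp_act_cons[OF \<phi> pw l'] fp_pull_cons[OF \<phi> pw l']
    using IH D by (simp add: \<psi>w_def \<phi>w_def)
qed (simp add: fp_act_def)

theorem crossed_group_coprod: "crossed_group A (coprod A G H)"
proof (rule G.crossed_groupI)
  show "group (grp (coprod A G H) a)" if "a \<in> Obj A" for a
    using that by (simp add: coprod_def group_free_product G.grp H.grp)
qed (auto simp: coprod_def free_product_def fp_pull_Ident fp_pull_closed fp_act_closed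
    reduced_words_letters fp_Comp fp_pull_mult fp_act_mult, simp add: fp_act_def)

end

theorem crossed_hom_inl_inr:
  assumes "crossed_group A G" "crossed_group A H"
  shows "crossed_hom A G (coprod A G H) (inl G)" "crossed_hom A H (coprod A G H) (inr H)"
proof -
  interpret two_crossed_groups A G H using assms by (rule two_crossed_groups.intro)
  have 1: "\<one>\<^bsub>grp G a\<^esub> \<in> elts G a" "\<one>\<^bsub>grp H a\<^esub> \<in> elts H a" if "a \<in> Obj A" for a
    using G.grp[OF that] H.grp[OF that] by (simp_all add: group.is_monoid)
  show "crossed_hom A G (coprod A G H) (inl G)"
    unfolding crossed_hom_def presheaf_map_def
  proof (intro conjI ballI funcsetI homI)
    fix a x y assume a: "a \<in> Obj A" and x: "x \<in> elts G a" and y: "y \<in> elts G a"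
    interpret group "grp G a" by (rule G.grp[OF a])
    show "inl G a (x \<otimes>\<^bsub>grp G a\<^esub> y) =
        inl G a x \<otimes>\<^bsub>grp (coprod A G H) a\<^esub> inl G a y"
      using x y by (auto simp: inl_def coprod_def free_product_def)
  next
    fix a b \<phi> x assume *: "a \<in> Obj A" "b \<in> Obj A" "\<phi> \<in> Hom A a b" "x \<in> elts G b"
    show "inl G a (pull G \<phi> x) = pull (coprod A G H) \<phi> (inl G b x)"
      using * Hom_Dom[OF *(3)] by (auto simp: inl_def coprod_def G.pull_one fp_act_def)
    show "act (coprod A G H) (inl G b x) \<phi> = act G x \<phi>"
      using * by (auto simp: inl_def coprod_def G.act_one fp_act_def)
  qed (auto simp: inl_def coprod_def free_product_def reduced_words_def)
  show "crossed_hom A H (coprod A G H) (inr H)"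
    unfolding crossed_hom_def presheaf_map_def
  proof (intro conjI ballI funcsetI homI)
    fix a x y assume a: "a \<in> Obj A" and x: "x \<in> elts H a" and y: "y \<in> elts H a"
    interpret group "grp H a" by (rule H.grp[OF a])
    show "inr H a (x \<otimes>\<^bsub>grp H a\<^esub> y) =
        inr H a x \<otimes>\<^bsub>grp (coprod A G H) a\<^esub> inr H a y"
      using x y by (auto simp: inr_def coprod_def free_product_def)
  next
    fix a b \<phi> x assume *: "a \<in> Obj A" "b \<in> Obj A" "\<phi> \<in> Hom A a b" "x \<in> elts H b"
    show "inr H a (pull H \<phi> x) = pull (coprod A G H) \<phi> (inr H b x)"
      using * Hom_Dom[OF *(3)] by (auto simp: inr_def coprod_def H.pull_one fp_act_def)
    show "act (coprod A G H) (inr H b x) \<phi> = act H x \<phi>"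
      using * by (auto simp: inr_def coprod_def H.act_one fp_act_def)
  qed (auto simp: inr_def coprod_def free_product_def reduced_words_def)
qed

context
  fixes A :: "('o, 'm) cat" and G :: "('o, 'm, 'g) crossed" and H :: "('o, 'm, 'h) crossed"
    and L :: "('o, 'm, 'k) crossed" and u v
  assumes G: "crossed_group A G" and H: "crossed_group A H" and L: "crossed_group A L"
    and u: "crossed_hom A G L u" and v: "crossed_hom A H L v"
begin

interpretation two_crossed_groups A G H using G H by (rule two_crossed_groups.intro)
interpretation L: crossed_group A L by (rule L)

lemma la_copair:
  assumes "a \<in> Obj A"
  shows "letter_action (grp G a) (grp H a) (elts L a)
    (\<lambda>l y. case_sum (u a) (v a) l \<otimes>\<^bsub>grp L a\<^esub> y)"
proof -
  interpret La: group "grp L a" by (rule L.grp[OF assms])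
  have 1: "u a \<one>\<^bsub>grp G a\<^esub> = \<one>\<^bsub>grp L a\<^esub>" "v a \<one>\<^bsub>grp H a\<^esub> = \<one>\<^bsub>grp L a\<^esub>"
    using hom_one[OF crossed_homD(1)[OF u]] hom_one[OF crossed_homD(1)[OF v]]
      assms G.grp H.grp L.grp by blast+
  show ?thesis
    using assms
    by (intro letter_action.intro letter_action_axioms.intro G.grp H.grp)
      (auto simp: letters_def 1 La.m_assoc crossed_homD(2,3)[OF u] crossed_homD(2,3)[OF v])
qed

lemma copair_closed:
  assumes "a \<in> Obj A" "set w \<subseteq> lts a" shows "copair L u v a w \<in> elts L a"
  unfolding copair_def
  using letter_action.foldr_closed[OF la_copair assms(2)] assms L.grp[THEN group.is_monoid]
  by (simp add: monoid.one_closed)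

lemma copair_cons:
  assumes "a \<in> Obj A" "set w \<subseteq> lts a" "l \<in> lts a"
  shows "copair L u v a (cons a l w) = case_sum (u a) (v a) l \<otimes>\<^bsub>grp L a\<^esub> copair L u v a w"
  unfolding copair_def
  using letter_action.foldr_fp_cons[OF la_copair assms(3,2)] assms L.grp[THEN group.is_monoid]
  by (simp add: monoid.one_closed)

lemma copair_mult:
  assumes a: "a \<in> Obj A" and z: "set z \<subseteq> lts a" and w: "set w \<subseteq> lts a"
  shows "copair L u v a (foldr (cons a) w z) =
    copair L u v a w \<otimes>\<^bsub>grp L a\<^esub> copair L u v a z"
  using w
proof (induction w)
  interpret La: group "grp L a" by (rule L.grp[OF a])
  case Nil
  then show ?case using copair_closed[OF a z] by (simp add: copair_def)
next
  interpret La: group "grp L a" by (rule L.grp[OF a])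
  case (Cons l w)
  then have l: "l \<in> lts a" and w: "set w \<subseteq> lts a" by auto
  have m: "set (foldr (cons a) w z) \<subseteq> lts a"
    using letter_action.foldr_mult[OF la_cons[OF a] z reduced_words_Nil w] by blast
  have c: "case_sum (u a) (v a) l \<in> elts L a"
    using l a by (auto simp: letters_def crossed_homD(2)[OF u] crossed_homD(2)[OF v])
  have "copair L u v a (l # w) = case_sum (u a) (v a) l \<otimes>\<^bsub>grp L a\<^esub> copair L u v a w"
    by (simp add: copair_def)
  then show ?case
    using Cons.IH[OF w] copair_cons[OF a m l] c copair_closed[OF a w] copair_closed[OF a z]
    by (simp add: La.m_assoc)
qed

lemma copair_pull:
  assumes \<phi>: "\<phi> \<in> Hom A a b"
  shows "set w \<subseteq> lts b \<Longrightarrow>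
    act L (copair L u v b w) \<phi> = fp_act G H w \<phi> \<and>
    copair L u v a (fp_pull A G H \<phi> w) = pull L \<phi> (copair L u v b w)"
proof (induction w)
  case Nil
  then show ?case by (simp add: copair_def L.act_one[OF \<phi>] L.pull_one[OF \<phi>] fp_act_def)
next
  case (Cons l w)
  note O = HomO[OF \<phi>]
  from Cons have l: "l \<in> lts b" and w: "set w \<subseteq> lts b" by auto
  define \<phi>w where "\<phi>w = fp_act G H w \<phi>"
  have \<phi>w: "\<phi>w \<in> Hom A a b" unfolding \<phi>w_def by (rule fp_act_closed[OF \<phi> w])
  define x where "x = case_sum (u b) (v b) l"
  have x: "x \<in> elts L b"
    using l O by (auto simp: x_def letters_def crossed_homD(2)[OF u] crossed_homD(2)[OF v])
  have c: "copair L u v b w \<in> elts L b" by (rule copair_closed[OF O(2) w])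
  have e: "copair L u v b (l # w) = x \<otimes>\<^bsub>grp L b\<^esub> copair L u v b w"
    by (simp add: copair_def x_def)
  have xa: "act L x \<phi>w = lact l \<phi>w"
    using l by (auto simp: x_def letters_def crossed_homD(5)[OF u G.small_category_axioms \<phi>w]
        crossed_homD(5)[OF v G.small_category_axioms \<phi>w])
  have xp: "case_sum (u a) (v a) (lpull \<phi>w l) = pull L \<phi>w x"
    using l by (auto simp: x_def letters_def crossed_homD(4)[OF u G.small_category_axioms \<phi>w]
        crossed_homD(4)[OF v G.small_category_axioms \<phi>w])
  have pw: "set (fp_pull A G H \<phi> w) \<subseteq> lts a"
    using fp_pull_closed[OF \<phi> w] reduced_words_letters by blast
  show ?case
    using Cons.IH[OF w] Hom_Dom[OF \<phi>] copair_cons[OF O(1) pw lpull_closed[OF \<phi>w l]]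
      xa xp
    by (simp add: e L.act_mult[OF \<phi> x c] L.pull_mult[OF \<phi> x c] flip: \<phi>w_def)
      (simp add: \<phi>w_def fp_act_def)
qed

theorem crossed_hom_copair: "crossed_hom A (coprod A G H) L (copair L u v)"
  by (auto simp: crossed_hom_def presheaf_map_def coprod_def free_product_def copair_pull
      reduced_words_letters copair_closed copair_mult intro!: homI)

theorem copair_inl_inr:
  assumes "a \<in> Obj A"
  shows "x \<in> elts G a \<Longrightarrow> copair L u v a (inl G a x) = u a x"
    and "y \<in> elts H a \<Longrightarrow> copair L u v a (inr H a y) = v a y"
proof -
  interpret La: group "grp L a" by (rule L.grp[OF assms])
  have 1: "u a \<one>\<^bsub>grp G a\<^esub> = \<one>\<^bsub>grp L a\<^esub>" "v a \<one>\<^bsub>grp H a\<^esub> = \<one>\<^bsub>grp L a\<^esub>"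
    using hom_one[OF crossed_homD(1)[OF u]] hom_one[OF crossed_homD(1)[OF v]]
      assms G.grp H.grp L.grp by blast+
  show "x \<in> elts G a \<Longrightarrow> copair L u v a (inl G a x) = u a x"
    "y \<in> elts H a \<Longrightarrow> copair L u v a (inr H a y) = v a y"
    using assms by (auto simp: copair_def inl_def inr_def 1 crossed_homD(2)[OF u] crossed_homD(2)[OF v])
qed

theorem copair_unique:
  assumes h: "crossed_hom A (coprod A G H) L h"
    and hu: "\<And>a x. a \<in> Obj A \<Longrightarrow> x \<in> elts G a \<Longrightarrow> h a (inl G a x) = u a x"
    and hv: "\<And>a y. a \<in> Obj A \<Longrightarrow> y \<in> elts H a \<Longrightarrow> h a (inr H a y) = v a y"
    and a: "a \<in> Obj A" and w: "w \<in> elts (coprod A G H) a"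
  shows "h a w = copair L u v a w"
proof -
  have "w \<in> rw a" using w by (simp add: coprod_def free_product_def)
  then show ?thesis
  proof (induction w)
    case Nil
    have "h a \<one>\<^bsub>grp (coprod A G H) a\<^esub> = \<one>\<^bsub>grp L a\<^esub>"
      using hom_one[OF crossed_homD(1)[OF h a]] L.grp[OF a]
        crossed_group.grp[OF crossed_group_coprod a] by blast
    then show ?case by (simp add: copair_def coprod_def free_product_def)
  next
    case (Cons l w)
    then have w: "w \<in> rw a" and l: "l \<in> lts a" and l1: "[l] \<in> rw a"
      by (auto simp: reduced_words_Cons reduced_words_Nil)
    have "h a ([l] \<otimes>\<^bsub>grp (coprod A G H) a\<^esub> w) = h a [l] \<otimes>\<^bsub>grp L a\<^esub> h a w"
      using w l1 by (intro crossed_homD(3)[OF h a]) (auto simp: coprod_def free_product_def)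
    moreover have "[l] \<otimes>\<^bsub>grp (coprod A G H) a\<^esub> w = l # w"
      using fp_cons_reduced_Cons[OF Cons.prems] by (simp add: coprod_def free_product_def)
    moreover have "h a [l] = case_sum (u a) (v a) l"
      using l l1 hu[OF a] hv[OF a]
      by (fastforce simp: letters_def inl_def inr_def reduced_words_Cons split: if_splits)
    ultimately show ?case using Cons.IH[OF w] by (simp add: copair_def)
  qed
qed

end


subsection \<open>Epimorphisms cancel against targets of any type\<close>

lemma crossed_hom_comp:
  assumes "crossed_hom A G H f" "crossed_hom A H L g"
  shows "crossed_hom A G L (\<lambda>a x. g a (f a x))"
  using assms by (fastforce simp: crossed_hom_def presheaf_map_def hom_def Pi_iff)

lemma crossed_hom_corestrict:
  assumes "crossed_hom A G L f" "\<And>a x. a \<in> Obj A \<Longrightarrow> x \<in> elts G a \<Longrightarrow> f a x \<in> K a"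
  shows "crossed_hom A G (sub L K) f"
  using assms by (auto simp: crossed_hom_def presheaf_map_def hom_def sub_def Pi_iff)

lemma crossed_subgroup_image:
  assumes "crossed_group A G" "crossed_group A L" "crossed_hom A G L f"
  shows "crossed_subgroup A L (\<lambda>a. f a ` elts G a)"
proof -
  interpret G: crossed_group A G by fact
  interpret L: crossed_group A L by fact
  have "subgroup (f a ` elts G a) (grp L a)" if "a \<in> Obj A" for a
    using group_hom.img_is_subgroup[of "grp G a" "grp L a" "f a"] G.grp L.grp that
      crossed_homD(1)[OF assms(3)]
    by (simp add: group_hom_def group_hom_axioms_def)
  moreover have "pull L \<phi> (f b x) \<in> f a ` elts G a" if "\<phi> \<in> Hom A a b" "x \<in> elts G b" for a b \<phi> x
    using crossed_homD(4)[OF assms(3) G.small_category_axioms that] G.p_closed[OF that]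
    by (metis imageI)
  ultimately show ?thesis by (auto simp: crossed_subgroup_def)
qed

definition transport ::
  "('o, 'm) cat \<Rightarrow> ('o, 'm, 'g) crossed \<Rightarrow> ('o \<Rightarrow> 'g \<Rightarrow> 'h) \<Rightarrow> ('o, 'm, 'h) crossed" where
  "transport A L h = (let k = (\<lambda>a. the_inv_into (elts L a) (h a)) in
    \<lparr>grp = \<lambda>a. \<lparr>carrier = h a ` elts L a,
       mult = \<lambda>x y. h a (k a x \<otimes>\<^bsub>grp L a\<^esub> k a y), one = h a \<one>\<^bsub>grp L a\<^esub>\<rparr>,
     pull = \<lambda>\<phi> x. h (Dom A \<phi>) (pull L \<phi> (k (Cod A \<phi>) x)),
     act = \<lambda>x \<phi>. act L (k (Cod A \<phi>) x) \<phi>\<rparr>)"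

lemma transport:
  assumes "crossed_group A L" and inj: "\<And>a. a \<in> Obj A \<Longrightarrow> inj_on (h a) (elts L a)"
  shows "crossed_group A (transport A L h)" "crossed_hom A L (transport A L h) h"
proof -
  interpret L: crossed_group A L by fact
  define k where "k = (\<lambda>a. the_inv_into (elts L a) (h a))"
  have k: "k a (h a x) = x" if "a \<in> Obj A" "x \<in> elts L a" for a x
    using the_inv_into_f_f[OF inj] that by (simp add: k_def)
  have e: "elts (transport A L h) a = h a ` elts L a"
    "\<one>\<^bsub>grp (transport A L h) a\<^esub> = h a \<one>\<^bsub>grp L a\<^esub>"
    "x \<otimes>\<^bsub>grp (transport A L h) a\<^esub> y = h a (k a x \<otimes>\<^bsub>grp L a\<^esub> k a y)"
    "pull (transport A L h) \<phi> x = h (Dom A \<phi>) (pull L \<phi> (k (Cod A \<phi>) x))"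
    "act (transport A L h) x \<phi> = act L (k (Cod A \<phi>) x) \<phi>" for a x y \<phi>
    by (simp_all add: transport_def k_def)
  note one = L.grp[THEN group.is_monoid, THEN monoid.one_closed]
  note mlt = L.grp[THEN group.is_monoid, THEN monoid.m_closed]
  have P: "pull (transport A L h) \<phi> (h b x) = h a (pull L \<phi> x)"
    "act (transport A L h) (h b x) \<phi> = act L x \<phi>"
    if "\<phi> \<in> Hom A a b" "x \<in> elts L b" for a b \<phi> x
    using that L.Hom_Obj by (auto simp: e Hom_Dom[OF that(1)] Hom_Cod[OF that(1)] k)
  have M: "h a x \<otimes>\<^bsub>grp (transport A L h) a\<^esub> h a y = h a (x \<otimes>\<^bsub>grp L a\<^esub> y)"
    if "a \<in> Obj A" "x \<in> elts L a" "y \<in> elts L a" for a x y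
    using that by (simp add: e k)
  show "crossed_group A (transport A L h)"
  proof (rule L.crossed_groupI)
    fix a assume a: "a \<in> Obj A"
    interpret La: group "grp L a" by (rule L.grp[OF a])
    show "group (grp (transport A L h) a)"
    proof (rule groupI)
      fix x assume "x \<in> elts (transport A L h) a"
      then obtain x' where x': "x' \<in> elts L a" "x = h a x'" by (auto simp: e)
      then show "\<exists>y\<in>elts (transport A L h) a.
          y \<otimes>\<^bsub>grp (transport A L h) a\<^esub> x = \<one>\<^bsub>grp (transport A L h) a\<^esub>"
        using M[OF a] by (intro bexI[of _ "h a (inv\<^bsub>grp L a\<^esub> x')"]) (auto simp: e(1,2))
    qed (auto simp: e k a La.m_assoc)
  next
    fix a x assume "a \<in> Obj A" "x \<in> elts (transport A L h) a"
    then show "pull (transport A L h) (Ident A a) x = x"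
      using P(1)[OF L.Ident_Hom] by (auto simp: e(1) L.p_Ident)
  next
    fix a b \<phi> x assume *: "\<phi> \<in> Hom A a b" "x \<in> elts (transport A L h) b"
    then show "pull (transport A L h) \<phi> x \<in> elts (transport A L h) a"
      using P(1) L.p_closed by (auto simp: e(1))
    show "act (transport A L h) x \<phi> \<in> Hom A a b"
      using * P(2) L.act_closed by (auto simp: e(1))
  next
    fix a b \<phi> assume \<phi>: "\<phi> \<in> Hom A a b"
    show "act (transport A L h) \<one>\<^bsub>grp (transport A L h) b\<^esub> \<phi> = \<phi>"
      using P(2)[OF \<phi> one] L.act_one[OF \<phi>] L.Hom_Obj[OF \<phi>] by (simp add: e(2))
  next
    fix a b \<phi> x y
    assume \<phi>: "\<phi> \<in> Hom A a b" and "x \<in> elts (transport A L h) b" "y \<in> elts (transport A L h) b"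
    then obtain x' y' where x: "x' \<in> elts L b" "x = h b x'" and y: "y' \<in> elts L b" "y = h b y'"
      by (auto simp: e(1))
    note O = L.Hom_Obj[OF \<phi>]
    note c = mlt[OF O(2) x(1) y(1)] L.act_closed[OF \<phi> y(1)] L.p_closed[OF \<phi> y(1)]
    show "act (transport A L h) (x \<otimes>\<^bsub>grp (transport A L h) b\<^esub> y) \<phi> =
        act (transport A L h) x (act (transport A L h) y \<phi>)"
      using \<phi> x y c O by (simp add: P M L.act_mult)
    show "pull (transport A L h) \<phi> (x \<otimes>\<^bsub>grp (transport A L h) b\<^esub> y) =
        pull (transport A L h) (act (transport A L h) y \<phi>) x
          \<otimes>\<^bsub>grp (transport A L h) a\<^esub> pull (transport A L h) \<phi> y"
      using x y O M[OF O(1) L.p_closed[OF c(2) x(1)] c(3)]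
      by (simp add: P(1)[OF \<phi> c(1)] P(2)[OF \<phi> y(1)] P(1)[OF \<phi> y(1)] P(1)[OF c(2) x(1)] M
          L.pull_mult[OF \<phi> x(1) y(1)])
  next
    fix a b c \<phi> \<psi> x
    assume \<phi>: "\<phi> \<in> Hom A a b" and \<psi>: "\<psi> \<in> Hom A b c" and "x \<in> elts (transport A L h) c"
    then obtain x' where x: "x' \<in> elts L c" "x = h c x'" by (auto simp: e(1))
    note C = L.Comp_Hom[OF \<phi> \<psi>] L.p_closed[OF \<psi> x(1)]
    show "pull (transport A L h) (Comp A \<psi> \<phi>) x = pull (transport A L h) \<phi> (pull (transport A L h) \<psi> x)"
      by (simp add: x(2) P(1)[OF C(1) x(1)] P(1)[OF \<psi> x(1)] P(1)[OF \<phi> C(2)] L.p_Comp[OF \<phi> \<psi> x(1)])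
    show "act (transport A L h) x (Comp A \<psi> \<phi>) =
        Comp A (act (transport A L h) x \<psi>) (act (transport A L h) (pull (transport A L h) \<psi> x) \<phi>)"
      by (simp add: x(2) P(2)[OF C(1) x(1)] P[OF \<psi> x(1)] P(2)[OF \<phi> C(2)] L.act_Comp[OF \<phi> \<psi> x(1)])
  qed
  show "crossed_hom A L (transport A L h) h"
    unfolding crossed_hom_def presheaf_map_def by (auto simp: P M e(1) intro!: homI)
qed

theorem crossed_epi_cancel:
  fixes L :: "('o, 'm, 'k) crossed"
  assumes epi: "crossed_epi A P H f" and H: "crossed_group A H"
    and L: "crossed_group A L" and u: "crossed_hom A H L u" and v: "crossed_hom A H L v"
    and uv: "\<And>a x. a \<in> Obj A \<Longrightarrow> x \<in> elts P a \<Longrightarrow> u a (f a x) = v a (f a x)"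
    and a: "a \<in> Obj A" and y: "y \<in> elts H a"
  shows "u a y = v a y"
proof -
  interpret two_crossed_groups A H H using H by (intro two_crossed_groups.intro)
  define W where "W = coprod A H H"
  define c where "c = copair L u v"
  define K where "K = (\<lambda>a. c a ` elts W a)"
  define h where "h = (\<lambda>a z. {w \<in> elts W a. c a w = z})"
  define L' where "L' = transport A (sub L K) h"
  have W: "crossed_group A W" unfolding W_def by (rule crossed_group_coprod)
  have c: "crossed_hom A W L c"
    unfolding W_def c_def by (rule crossed_hom_copair[OF H H L u v])
  have K: "crossed_subgroup A L K"
    unfolding K_def by (rule crossed_subgroup_image[OF W L c])
  have S: "crossed_group A (sub L K)" by (rule crossed_group_sub[OF L K])
  have inj: "inj_on (h b) (K b)" for b
  proof (rule inj_onI)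
    fix y z assume "y \<in> K b" and yz: "h b y = h b z"
    then obtain w where "w \<in> h b y" "c b w = y" by (auto simp: K_def h_def)
    with yz show "y = z" by (simp add: h_def)
  qed
  then have "inj_on (h b) (elts (sub L K) b)" for b by (simp add: sub_def)
  then have L': "crossed_group A L'" "crossed_hom A (sub L K) L' h"
    unfolding L'_def by (rule transport[OF S])+
  have uvK: "u b z \<in> K b" "v b z \<in> K b" if "b \<in> Obj A" "z \<in> elts H b" for b z
  proof -
    have "inl H b z \<in> elts W b" "inr H b z \<in> elts W b"
      using crossed_homD(2)[OF crossed_hom_inl_inr(1)[OF H H]]
        crossed_homD(2)[OF crossed_hom_inl_inr(2)[OF H H]] that by (simp_all add: W_def)
    moreover have "c b (inl H b z) = u b z" "c b (inr H b z) = v b z"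
      using copair_inl_inr[OF H H L u v that(1)] that(2) by (simp_all add: c_def)
    ultimately show "u b z \<in> K b" "v b z \<in> K b"
      unfolding K_def by (metis image_eqI)+
  qed
  have "crossed_hom A H L' (\<lambda>a x. h a (u a x))" "crossed_hom A H L' (\<lambda>a x. h a (v a x))"
    using crossed_hom_comp[OF crossed_hom_corestrict[OF u uvK(1)] L'(2)]
      crossed_hom_comp[OF crossed_hom_corestrict[OF v uvK(2)] L'(2)] by simp_all
  moreover have "\<forall>a\<in>Obj A. \<forall>x\<in>elts P a. h a (u a (f a x)) = h a (v a (f a x))"
    by (simp add: uv)
  moreover note epi[unfolded crossed_epi_def, THEN conjunct2, THEN spec, of L', THEN spec,
      of "\<lambda>a x. h a (u a x)", THEN spec, of "\<lambda>a x. h a (v a x)"]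
  ultimately have "\<forall>a\<in>Obj A. \<forall>y\<in>elts H a. h a (u a y) = h a (v a y)"
    using L'(1) by argo
  then have "h a (u a y) = h a (v a y)" using a y by simp
  then show ?thesis by (rule inj_onD[OF inj _ uvK[OF a y]])
qed

lemma crossed_epi_if_surj:
  assumes "crossed_hom A G H f" "\<And>a. a \<in> Obj A \<Longrightarrow> f a ` elts G a = elts H a"
  shows "crossed_epi A G H f"
  using assms(1) assms(2)[symmetric] by (auto simp: crossed_epi_def)


subsection \<open>Quotients\<close>

context
  fixes A :: "('o, 'm) cat" and H :: "('o, 'm, 'g) crossed" and N :: "'o \<Rightarrow> 'g set"
  assumes H: "crossed_group A H" and N: "crossed_subgroup A H N"
    and normal: "\<And>a. a \<in> Obj A \<Longrightarrow> N a \<lhd> grp H a"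
begin

interpretation crossed_group A H by (rule H)

lemma quot_pull_coset:
  assumes \<phi>: "\<phi> \<in> Hom A a b" and x: "x \<in> elts H b"
  shows "quot_pull A H N \<phi> (N b #>\<^bsub>grp H b\<^esub> x) = N a #>\<^bsub>grp H a\<^esub> pull H \<phi> x"
proof -
  note O = Hom_Obj[OF \<phi>]
  interpret Na: normal "N a" "grp H a" by (rule normal[OF O(1)])
  interpret Nb: normal "N b" "grp H b" by (rule normal[OF O(2)])
  have "N a #>\<^bsub>grp H a\<^esub> pull H \<phi> (n \<otimes>\<^bsub>grp H b\<^esub> x) = N a #>\<^bsub>grp H a\<^esub> pull H \<phi> x"
    if n: "n \<in> N b" for n
  proof -
    have p: "pull H (act H x \<phi>) n \<in> N a"
      using N act_closed[OF \<phi> x] n O by (auto simp: crossed_subgroup_def)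
    have "N a #>\<^bsub>grp H a\<^esub> pull H \<phi> (n \<otimes>\<^bsub>grp H b\<^esub> x) =
        (N a #>\<^bsub>grp H a\<^esub> pull H (act H x \<phi>) n) #>\<^bsub>grp H a\<^esub> pull H \<phi> x"
      using pull_mult[OF \<phi> _ x, of n] n p p_closed[OF \<phi> x] Na.subset Nb.subset
      by (auto simp: Na.coset_mult_assoc)
    also have "N a #>\<^bsub>grp H a\<^esub> pull H (act H x \<phi>) n = N a"
      using p by (simp add: Na.rcos_const)
    finally show ?thesis .
  qed
  moreover have "quot_pull A H N \<phi> (N b #>\<^bsub>grp H b\<^esub> x) =
      (\<Union>n\<in>N b. N a #>\<^bsub>grp H a\<^esub> pull H \<phi> (n \<otimes>\<^bsub>grp H b\<^esub> x))"
    by (auto simp: quot_pull_def Hom_Dom[OF \<phi>] r_coset_def set_mult_def)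
  moreover have "N b \<noteq> {}"
    using Nb.subgroup_axioms subgroup_nonempty by fastforce
  ultimately show ?thesis by (metis (no_types, lifting) SUP_eq_const)
qed

theorem presheaf_quot: "presheaf A (\<lambda>a. carrier (quot_grp H N a)) (quot_pull A H N)"
proof (intro presheaf.intro presheaf_axioms.intro small_category_axioms)
  fix a C assume a: "a \<in> Obj A" and "C \<in> carrier (quot_grp H N a)"
  then obtain x where "x \<in> elts H a" "C = N a #>\<^bsub>grp H a\<^esub> x"
    by (auto simp: quot_grp_def carrier_FactGroup)
  then show "quot_pull A H N (Ident A a) C = C"
    using quot_pull_coset[OF Ident_Hom[OF a]] p_Ident[OF a] by simp
next
  fix a b c \<phi> \<psi> C
  assume \<phi>: "\<phi> \<in> Hom A a b" and \<psi>: "\<psi> \<in> Hom A b c" and "C \<in> carrier (quot_grp H N c)"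
  then obtain x where "x \<in> elts H c" "C = N c #>\<^bsub>grp H c\<^esub> x"
    by (auto simp: quot_grp_def carrier_FactGroup)
  then show "quot_pull A H N (Comp A \<psi> \<phi>) C = quot_pull A H N \<phi> (quot_pull A H N \<psi> C)"
    using quot_pull_coset[OF Comp_Hom[OF \<phi> \<psi>]] quot_pull_coset[OF \<phi> p_closed[OF \<psi>]]
      quot_pull_coset[OF \<psi>] p_Comp[OF \<phi> \<psi>] by simp
qed (auto simp: quot_grp_def carrier_FactGroup quot_pull_coset intro!: imageI p_closed)

theorem presheaf_map_quot:
  "presheaf_map A (elts H) (pull H) (\<lambda>a. carrier (quot_grp H N a)) (quot_pull A H N)
    (\<lambda>a x. N a #>\<^bsub>grp H a\<^esub> x)"
  by (auto simp: presheaf_map_def quot_grp_def carrier_FactGroup quot_pull_coset)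

theorem quot_pull_unique:
  assumes "presheaf_map A (elts H) (pull H) (\<lambda>a. carrier (quot_grp H N a)) q
      (\<lambda>a x. N a #>\<^bsub>grp H a\<^esub> x)"
    and "\<phi> \<in> Hom A a b" "C \<in> carrier (quot_grp H N b)"
  shows "q \<phi> C = quot_pull A H N \<phi> C"
  using assms Hom_Obj[OF assms(2)]
  by (auto simp: presheaf_map_def quot_grp_def carrier_FactGroup quot_pull_coset)

end

end

(* An epimorphism of crossed groups is degreewise surjective: for a crossed subgroup K of G, let G
   act on the free abelian groups Z[K(a) \ G(a)] by translation. The semidirect product L is again a
   crossed group, and the inclusion G -> L and its conjugate by the trivial coset agree exactly on K.
   Taking for K the image of an epimorphism gives K = G. Hence a virtual product is degreewise the
   internal direct product of G1 and G2. Expanding the pullback of xy = yx in both orders and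
   comparing components shows that pullbacks act componentwise on it, so that Goursat's
   correspondence for groups, applied in each degree, respects the presheaf structures. *)

theory Submission
  imports Defs "HOL-Library.Poly_Mapping"
begin

section \<open>Epimorphisms are surjective\<close>

text \<open>For ordinary groups, a proper subgroup \<open>K\<close> is classically detected by two
  maps into the permutations of the cosets of \<open>K\<close> together with an extra point.
  Symmetric groups are not functorial in arbitrary maps of sets, such as the pullbacks between coset
  spaces, while free abelian groups are. Conjugation by the basis vector of the trivial coset takes
  over the role of the extra permutation; it is compatible with all pullbacks because a trivial
  coset always pulls back to a trivial coset. The recurring obstacle is that
  \<open>pull G \<phi>\<close> is a homomorphism only up to the twist by
  \<open>act G y \<phi>\<close>. In a virtual product the twist disappears for products of an
  element of \<open>G1\<close> with one of \<open>G2\<close>. Within one factor it may well remain,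
  but mixed products suffice, since every element of G is one and Goursat's relation between the two
  factors is stated through them.\<close>

definition map_frag :: "('a \<Rightarrow> 'b) \<Rightarrow> ('a \<Rightarrow>\<^sub>0 int) \<Rightarrow> 'b \<Rightarrow>\<^sub>0 int" where
  "map_frag f = frag_extend (frag_of \<circ> f)"

lemma map_frag_simps [simp]:
  "map_frag f 0 = 0" "map_frag f (frag_of c) = frag_of (f c)"
  "map_frag f (p + q) = map_frag f p + map_frag f q"
  "map_frag f (p - q) = map_frag f p - map_frag f q"
  "map_frag f (- p) = - map_frag f p"
  by (simp_all add: map_frag_def frag_extend_add frag_extend_diff frag_extend_minus)

lemma map_frag_cong:
  "(\<And>c. c \<in> Poly_Mapping.keys p \<Longrightarrow> f c = g c) \<Longrightarrow> map_frag f p = map_frag g p"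
  unfolding map_frag_def by (rule frag_extend_eq) simp

lemma map_frag_map_frag: "map_frag f (map_frag g p) = map_frag (\<lambda>c. f (g c)) p"
  using frag_extend_compose[of "frag_of \<circ> f" g p] by (simp add: map_frag_def comp_def)

lemma map_frag_ident: "(\<And>c. c \<in> Poly_Mapping.keys p \<Longrightarrow> f c = c) \<Longrightarrow> map_frag f p = p"
  using map_frag_cong[of p f id] frag_expansion[of p] by (simp add: map_frag_def)

lemma keys_map_frag: "Poly_Mapping.keys (map_frag f p) \<subseteq> f ` Poly_Mapping.keys p"
  using keys_frag_extend[of "frag_of \<circ> f" p] by (auto simp: map_frag_def keys_frag_of)

section \<open>Right cosets of a crossed subgroup, their pullbacks and translations\<close>

locale crossed_subgroup_cosets = crossed_group A G
  for A :: "('o, 'm) cat" and G :: "('o, 'm, 'g) crossed" +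
  fixes K :: "'o \<Rightarrow> 'g set"
  assumes K: "crossed_subgroup A G K"
begin

lemma K_subgroup: "a \<in> Obj A \<Longrightarrow> subgroup (K a) (grp G a)"
  and K_pull: "\<phi> \<in> Hom A a b \<Longrightarrow> x \<in> K b \<Longrightarrow> pull G \<phi> x \<in> K a"
  using K Hom_Obj[of \<phi> a b] by (auto simp: crossed_subgroup_def)

abbreviation cosets :: "'o \<Rightarrow> 'g set set" where
  "cosets a \<equiv> rcosets\<^bsub>grp G a\<^esub> K a"

lemma cosetE:
  assumes "C \<in> cosets a"
  obtains x where "x \<in> elts G a" "C = K a #>\<^bsub>grp G a\<^esub> x"
  using assms by (auto simp: RCOSETS_def)

lemma cosetI: "x \<in> elts G a \<Longrightarrow> K a #>\<^bsub>grp G a\<^esub> x \<in> cosets a"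
  by (auto simp: RCOSETS_def)

text \<open>Multiplying \<open>x\<close> on the left by \<open>n\<close> in \<open>K b\<close>
  changes its pullback by the left factor \<open>pull G (act G x \<phi>) n\<close>, which lies in
  \<open>K a\<close> and is absorbed by the right coset. \<open>K\<close> is only a family of
  subgroups here, as the image of an epimorphism is not known to be normal.\<close>

lemma pull_coset:
  assumes \<phi>: "\<phi> \<in> Hom A a b" and x: "x \<in> elts G b"
  shows "quot_pull A G K \<phi> (K b #>\<^bsub>grp G b\<^esub> x) = K a #>\<^bsub>grp G a\<^esub> pull G \<phi> x"
proof -
  note O = Hom_Obj[OF \<phi>]
  interpret Ga: group "grp G a" by (rule grp[OF O(1)])
  interpret Gb: group "grp G b" by (rule grp[OF O(2)])
  interpret Ka: subgroup "K a" "grp G a" by (rule K_subgroup[OF O(1)])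
  interpret Kb: subgroup "K b" "grp G b" by (rule K_subgroup[OF O(2)])
  have "K a #>\<^bsub>grp G a\<^esub> pull G \<phi> (n \<otimes>\<^bsub>grp G b\<^esub> x) = K a #>\<^bsub>grp G a\<^esub> pull G \<phi> x"
    if n: "n \<in> K b" for n
  proof -
    have p: "pull G (act G x \<phi>) n \<in> K a" by (rule K_pull[OF act_closed[OF \<phi> x] n])
    have "K a #>\<^bsub>grp G a\<^esub> pull G \<phi> (n \<otimes>\<^bsub>grp G b\<^esub> x) =
        (K a #>\<^bsub>grp G a\<^esub> pull G (act G x \<phi>) n) #>\<^bsub>grp G a\<^esub> pull G \<phi> x"
      using pull_mult[OF \<phi> _ x, of n] n p p_closed[OF \<phi> x] Ka.subset Kb.subset
      by (auto simp: Ga.coset_mult_assoc)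
    also have "K a #>\<^bsub>grp G a\<^esub> pull G (act G x \<phi>) n = K a"
      using p by (simp add: Ka.rcos_const Ga.is_group)
    finally show ?thesis .
  qed
  \<comment> \<open>As a union over representatives of the coset, all of whose members have just
    been shown to be equal.\<close>
  moreover have "quot_pull A G K \<phi> (K b #>\<^bsub>grp G b\<^esub> x) =
      (\<Union>n\<in>K b. K a #>\<^bsub>grp G a\<^esub> pull G \<phi> (n \<otimes>\<^bsub>grp G b\<^esub> x))"
    by (auto simp: quot_pull_def Hom_Dom[OF \<phi>] r_coset_def set_mult_def)
  moreover have "K b \<noteq> {}" using Kb.one_closed by blast
  ultimately show ?thesis by (metis (no_types, lifting) SUP_eq_const)
qed

lemma pull_coset_closed: "\<phi> \<in> Hom A a b \<Longrightarrow> C \<in> cosets b \<Longrightarrow> quot_pull A G K \<phi> C \<in> cosets a"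
  by (auto elim!: cosetE simp: pull_coset intro!: cosetI p_closed)

text \<open>The inverse makes right multiplication on right cosets a left action.\<close>

abbreviation translate :: "'o \<Rightarrow> 'g \<Rightarrow> 'g set \<Rightarrow> 'g set" where
  "translate a x C \<equiv> C #>\<^bsub>grp G a\<^esub> inv\<^bsub>grp G a\<^esub> x"

lemma translate_coset:
  assumes "a \<in> Obj A" "x \<in> elts G a" "y \<in> elts G a"
  shows "translate a x (K a #>\<^bsub>grp G a\<^esub> y) = K a #>\<^bsub>grp G a\<^esub> (y \<otimes>\<^bsub>grp G a\<^esub> inv\<^bsub>grp G a\<^esub> x)"
proof -
  interpret group "grp G a" by (rule grp[OF assms(1)])
  show ?thesis
    using assms subgroup.subset[OF K_subgroup[OF assms(1)]] by (simp add: coset_mult_assoc)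
qed

lemma translate_closed:
  assumes "a \<in> Obj A" "x \<in> elts G a" "C \<in> cosets a" shows "translate a x C \<in> cosets a"
proof -
  interpret group "grp G a" by (rule grp[OF assms(1)])
  show ?thesis using assms by (auto elim!: cosetE simp: translate_coset intro!: cosetI)
qed

lemma translate_one:
  assumes "a \<in> Obj A" "C \<in> cosets a" shows "translate a \<one>\<^bsub>grp G a\<^esub> C = C"
proof -
  interpret group "grp G a" by (rule grp[OF assms(1)])
  show ?thesis
    using assms(2) subgroup.subset[OF K_subgroup[OF assms(1)]]
    by (auto elim!: cosetE simp: coset_mult_assoc)
qed

lemma translate_mult:
  assumes "a \<in> Obj A" "x \<in> elts G a" "y \<in> elts G a" "C \<in> cosets a"
  shows "translate a (x \<otimes>\<^bsub>grp G a\<^esub> y) C = translate a x (translate a y C)"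
proof -
  interpret group "grp G a" by (rule grp[OF assms(1)])
  from assms(4) obtain z where "z \<in> elts G a" "C = K a #>\<^bsub>grp G a\<^esub> z" by (rule cosetE)
  then show ?thesis
    using assms(2,3) subgroup.subset[OF K_subgroup[OF assms(1)]]
    by (simp add: coset_mult_assoc inv_mult_group m_assoc)
qed

text \<open>Expanding the pullback of \<open>inv x \<otimes> x\<close> twists the arrow of the left
  factor, so the inverse of \<open>pull G \<phi> x\<close> is a pullback along
  \<open>act G x \<phi>\<close> and not along \<open>\<phi>\<close>.\<close>

lemma pull_inv:
  assumes \<phi>: "\<phi> \<in> Hom A a b" and x: "x \<in> elts G b"
  shows "pull G (act G x \<phi>) (inv\<^bsub>grp G b\<^esub> x) = inv\<^bsub>grp G a\<^esub> pull G \<phi> x"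
proof -
  interpret Ga: group "grp G a" by (rule grp[OF Hom_Obj(1)[OF \<phi>]])
  interpret Gb: group "grp G b" by (rule grp[OF Hom_Obj(2)[OF \<phi>]])
  have "pull G (act G x \<phi>) (inv\<^bsub>grp G b\<^esub> x) \<otimes>\<^bsub>grp G a\<^esub> pull G \<phi> x = \<one>\<^bsub>grp G a\<^esub>"
    using pull_mult[OF \<phi> Gb.inv_closed[OF x] x] x pull_one[OF \<phi>] by simp
  then show ?thesis
    by (metis Ga.inv_equality p_closed[OF \<phi> x] p_closed[OF act_closed[OF \<phi> x] Gb.inv_closed[OF x]])
qed

text \<open>Acting by \<open>inv x\<close> undoes the twist of \<open>\<phi>\<close> by
  \<open>x\<close>, so \<open>y \<otimes> inv x\<close> pulls back along the twisted arrow to the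
  pullback of \<open>y\<close> along \<open>\<phi>\<close>, divided by that of \<open>x\<close>.
  This equivariance is what makes the semidirect product satisfy \<open>pull_mult\<close>.\<close>

lemma pull_translate:
  assumes \<phi>: "\<phi> \<in> Hom A a b" and x: "x \<in> elts G b" and C: "C \<in> cosets b"
  shows "quot_pull A G K (act G x \<phi>) (translate b x C) =
    translate a (pull G \<phi> x) (quot_pull A G K \<phi> C)"
proof -
  interpret Gb: group "grp G b" by (rule grp[OF Hom_Obj(2)[OF \<phi>]])
  note O = Hom_Obj[OF \<phi>] and x' = act_closed[OF \<phi> x]
  from C obtain y where y: "y \<in> elts G b" "C = K b #>\<^bsub>grp G b\<^esub> y" by (rule cosetE)
  have "act G (inv\<^bsub>grp G b\<^esub> x) (act G x \<phi>) = \<phi>"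
    using act_mult[OF \<phi> Gb.inv_closed[OF x] x] x act_one[OF \<phi>] by simp
  then have "pull G (act G x \<phi>) (y \<otimes>\<^bsub>grp G b\<^esub> inv\<^bsub>grp G b\<^esub> x) =
      pull G \<phi> y \<otimes>\<^bsub>grp G a\<^esub> inv\<^bsub>grp G a\<^esub> pull G \<phi> x"
    using pull_mult[OF x' y(1) Gb.inv_closed[OF x]] pull_inv[OF \<phi> x] by simp
  then show ?thesis
    using x y O by (simp add: translate_coset pull_coset[OF x'] pull_coset[OF \<phi>] p_closed[OF \<phi>])
qed

text \<open>The semidirect product of \<open>G\<close> with the free abelian groups \<open>\<int>[K(a)\G(a)]\<close>. Cosets \<open>Kx\<close> are
  needed because \<open>\<phi>\<^sup>*(kx) = (\<phi>\<^sup>x)\<^sup>*(k) \<phi>\<^sup>*(x)\<close>, whereas \<open>xK\<close> is not mapped to a single coset.\<close>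

definition coset_ext :: "('o, 'm, ('g set \<Rightarrow>\<^sub>0 int) \<times> 'g) crossed" where
  "coset_ext = \<lparr>grp = \<lambda>a. \<lparr>carrier = {p. Poly_Mapping.keys p \<subseteq> cosets a} \<times> elts G a,
       mult = \<lambda>(p, x) (q, y). (p + map_frag (translate a x) q, x \<otimes>\<^bsub>grp G a\<^esub> y),
       one = (0, \<one>\<^bsub>grp G a\<^esub>)\<rparr>,
     pull = \<lambda>\<phi> (p, x). (map_frag (quot_pull A G K (act G x \<phi>)) p, pull G \<phi> x),
     act = \<lambda>(p, x). act G x\<rparr>"

section \<open>The semidirect product is a crossed group\<close>

lemma keys_add_cosets:
  "Poly_Mapping.keys p \<subseteq> S \<Longrightarrow> Poly_Mapping.keys q \<subseteq> S \<Longrightarrow> Poly_Mapping.keys (p + q) \<subseteq> S"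
  "Poly_Mapping.keys p \<subseteq> S \<Longrightarrow> Poly_Mapping.keys q \<subseteq> S \<Longrightarrow> Poly_Mapping.keys (p - q) \<subseteq> S"
  using Poly_Mapping.keys_add[of p q] keys_diff[of p q] by blast+

lemma keys_map_frag_cosets:
  "Poly_Mapping.keys p \<subseteq> S \<Longrightarrow> (\<And>C. C \<in> S \<Longrightarrow> f C \<in> T) \<Longrightarrow> Poly_Mapping.keys (map_frag f p) \<subseteq> T"
  using keys_map_frag[of f p] by blast

text \<open>The abelian part acts trivially on arrows. Since (p, x) = (p, 1)(0, x), the law
  \<open>pull_mult\<close> forces \<open>p\<close> to be pulled back along
  \<open>act G x \<phi>\<close>, as \<open>coset_ext\<close> prescribes. The laws then reduce to
  \<open>translate_mult\<close>, \<open>pull_translate\<close> and \<open>act_Comp\<close>.\<close>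

lemma crossed_group_coset_ext: "crossed_group A coset_ext"
proof (rule crossed_groupI)
  fix a assume a: "a \<in> Obj A"
  interpret Ga: group "grp G a" by (rule grp[OF a])
  have tr: "Poly_Mapping.keys (map_frag (translate a x) p) \<subseteq> cosets a"
    if "x \<in> elts G a" "Poly_Mapping.keys p \<subseteq> cosets a" for x p
    using keys_map_frag_cosets[OF that(2) translate_closed[OF a that(1)]] .
  have trm: "map_frag (translate a (x \<otimes>\<^bsub>grp G a\<^esub> y)) p =
      map_frag (translate a x) (map_frag (translate a y) p)"
    if "x \<in> elts G a" "y \<in> elts G a" "Poly_Mapping.keys p \<subseteq> cosets a" for x y p
    unfolding map_frag_map_frag
    by (rule map_frag_cong) (use that translate_mult[OF a that(1,2)] in blast)
  have tr1: "map_frag (translate a \<one>\<^bsub>grp G a\<^esub>) p = p" if "Poly_Mapping.keys p \<subseteq> cosets a" for p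
    by (rule map_frag_ident) (use that translate_one[OF a] in blast)
  show "group (grp coset_ext a)"
  proof (rule groupI)
    fix s assume "s \<in> elts coset_ext a"
    then obtain p x where s: "s = (p, x)" and p: "Poly_Mapping.keys p \<subseteq> cosets a"
      and x: "x \<in> elts G a" by (auto simp: coset_ext_def)
    let ?t = "(- map_frag (translate a (inv\<^bsub>grp G a\<^esub> x)) p, inv\<^bsub>grp G a\<^esub> x)"
    have "?t \<in> elts coset_ext a" "?t \<otimes>\<^bsub>grp coset_ext a\<^esub> s = \<one>\<^bsub>grp coset_ext a\<^esub>"
      using x tr[OF Ga.inv_closed[OF x] p] by (simp_all add: s coset_ext_def)
    then show "\<exists>t\<in>elts coset_ext a. t \<otimes>\<^bsub>grp coset_ext a\<^esub> s = \<one>\<^bsub>grp coset_ext a\<^esub>" by blast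
  next
    fix s t assume "s \<in> elts coset_ext a" "t \<in> elts coset_ext a"
    then show "s \<otimes>\<^bsub>grp coset_ext a\<^esub> t \<in> elts coset_ext a"
      by (clarsimp simp: coset_ext_def tr keys_add_cosets)
  next
    fix s t r assume "s \<in> elts coset_ext a" "t \<in> elts coset_ext a" "r \<in> elts coset_ext a"
    then show "s \<otimes>\<^bsub>grp coset_ext a\<^esub> t \<otimes>\<^bsub>grp coset_ext a\<^esub> r =
        s \<otimes>\<^bsub>grp coset_ext a\<^esub> (t \<otimes>\<^bsub>grp coset_ext a\<^esub> r)"
      by (clarsimp simp: coset_ext_def trm Ga.m_assoc add.assoc)
  next
    fix s assume "s \<in> elts coset_ext a"
    then show "\<one>\<^bsub>grp coset_ext a\<^esub> \<otimes>\<^bsub>grp coset_ext a\<^esub> s = s"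
      by (clarsimp simp: coset_ext_def tr1[simplified])
  qed (simp add: coset_ext_def)
next
  fix a s assume a: "a \<in> Obj A" and "s \<in> elts coset_ext a"
  then obtain p x where s: "s = (p, x)" and p: "Poly_Mapping.keys p \<subseteq> cosets a"
    and x: "x \<in> elts G a" by (auto simp: coset_ext_def)
  have "map_frag (quot_pull A G K (Ident A a)) p = p"
  proof (rule map_frag_ident)
    fix C assume "C \<in> Poly_Mapping.keys p"
    then have "C \<in> cosets a" using p by blast
    then show "quot_pull A G K (Ident A a) C = C"
      by (auto elim!: cosetE simp: pull_coset[OF Ident_Hom[OF a]] p_Ident[OF a])
  qed
  then show "pull coset_ext (Ident A a) s = s"
    using a x by (simp add: s coset_ext_def act_Ident p_Ident)
next
  fix a b \<phi> s assume \<phi>: "\<phi> \<in> Hom A a b" and "s \<in> elts coset_ext b"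
  then obtain p x where s: "s = (p, x)" and p: "Poly_Mapping.keys p \<subseteq> cosets b"
    and x: "x \<in> elts G b" by (auto simp: coset_ext_def)
  show "pull coset_ext \<phi> s \<in> elts coset_ext a"
    using p_closed[OF \<phi> x] keys_map_frag_cosets[OF p pull_coset_closed[OF act_closed[OF \<phi> x]]]
    by (simp add: s coset_ext_def)
  show "act coset_ext s \<phi> \<in> Hom A a b"
    using act_closed[OF \<phi> x] by (simp add: s coset_ext_def)
next
  fix a b \<phi> assume "\<phi> \<in> Hom A a b"
  then show "act coset_ext \<one>\<^bsub>grp coset_ext b\<^esub> \<phi> = \<phi>"
    by (simp add: coset_ext_def act_one)
next
  fix a b \<phi> s t assume \<phi>: "\<phi> \<in> Hom A a b" and "s \<in> elts coset_ext b" "t \<in> elts coset_ext b"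
  then obtain p x q y where s: "s = (p, x)" and p: "Poly_Mapping.keys p \<subseteq> cosets b"
    and x: "x \<in> elts G b" and t: "t = (q, y)" and q: "Poly_Mapping.keys q \<subseteq> cosets b"
    and y: "y \<in> elts G b" by (auto simp: coset_ext_def)
  have y': "act G y \<phi> \<in> Hom A a b" by (rule act_closed[OF \<phi> y])
  show "act coset_ext (s \<otimes>\<^bsub>grp coset_ext b\<^esub> t) \<phi> = act coset_ext s (act coset_ext t \<phi>)"
    using x y \<phi> by (simp add: s t coset_ext_def act_mult)
  \<comment> \<open>The two contributions of \<open>q\<close> to \<open>pull_mult\<close>:
    translating and then pulling back, or the reverse. They agree by \<open>pull_translate\<close>
    for the arrow \<open>act G y \<phi>\<close>.\<close>
  have "map_frag (\<lambda>C. quot_pull A G K (act G x (act G y \<phi>)) (translate b x C)) q =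
      map_frag (\<lambda>C. translate a (pull G (act G y \<phi>) x) (quot_pull A G K (act G y \<phi>) C)) q"
    by (rule map_frag_cong) (use q pull_translate[OF y' x] in blast)
  then show "pull coset_ext \<phi> (s \<otimes>\<^bsub>grp coset_ext b\<^esub> t) =
      pull coset_ext (act coset_ext t \<phi>) s \<otimes>\<^bsub>grp coset_ext a\<^esub> pull coset_ext \<phi> t"
    by (simp add: s t coset_ext_def act_mult[OF \<phi> x y] pull_mult[OF \<phi> x y] map_frag_map_frag)
next
  fix a b c \<phi> \<psi> s
  assume \<phi>: "\<phi> \<in> Hom A a b" and \<psi>: "\<psi> \<in> Hom A b c" and "s \<in> elts coset_ext c"
  then obtain p x where s: "s = (p, x)" and p: "Poly_Mapping.keys p \<subseteq> cosets c"
    and x: "x \<in> elts G c" by (auto simp: coset_ext_def)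
  note \<psi>x = act_closed[OF \<psi> x] and \<psi>p = p_closed[OF \<psi> x]
  note \<phi>x = act_closed[OF \<phi> \<psi>p]
  \<comment> \<open>This composite is the arrow obtained by twisting
    \<open>Comp A \<psi> \<phi>\<close> with \<open>x\<close>, by \<open>act_Comp\<close>.\<close>
  have "quot_pull A G K (Comp A (act G x \<psi>) (act G (pull G \<psi> x) \<phi>)) C =
      quot_pull A G K (act G (pull G \<psi> x) \<phi>) (quot_pull A G K (act G x \<psi>) C)"
    if "C \<in> Poly_Mapping.keys p" for C
  proof -
    from that p obtain y where "y \<in> elts G c" "C = K c #>\<^bsub>grp G c\<^esub> y" by (blast elim: cosetE)
    then show ?thesis
      by (simp add: pull_coset[OF \<psi>x] pull_coset[OF \<phi>x] pull_coset[OF Comp_Hom[OF \<phi>x \<psi>x]]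
          p_closed[OF \<psi>x] p_Comp[OF \<phi>x \<psi>x])
  qed
  then show "pull coset_ext (Comp A \<psi> \<phi>) s = pull coset_ext \<phi> (pull coset_ext \<psi> s)"
    by (simp add: s coset_ext_def act_Comp[OF \<phi> \<psi> x] p_Comp[OF \<phi> \<psi> x] map_frag_map_frag
        cong: map_frag_cong)
  show "act coset_ext s (Comp A \<psi> \<phi>) =
      Comp A (act coset_ext s \<psi>) (act coset_ext (pull coset_ext \<psi> s) \<phi>)"
    by (simp add: s coset_ext_def act_Comp[OF \<phi> \<psi> x])
qed

section \<open>Two maps that agree exactly on the crossed subgroup\<close>

definition coset_ext_incl :: "'o \<Rightarrow> 'g \<Rightarrow> ('g set \<Rightarrow>\<^sub>0 int) \<times> 'g" where
  "coset_ext_incl a x = (0, x)"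

text \<open>The conjugate of \<open>coset_ext_incl\<close> by the coset \<open>K(a)\<close>.\<close>

definition coset_ext_conj :: "'o \<Rightarrow> 'g \<Rightarrow> ('g set \<Rightarrow>\<^sub>0 int) \<times> 'g" where
  "coset_ext_conj a x = (frag_of (K a) - frag_of (translate a x (K a)), x)"

lemma K_coset: "a \<in> Obj A \<Longrightarrow> K a \<in> cosets a"
  by (metis K_subgroup cosetI group.coset_mult_one group.is_monoid grp monoid.one_closed subgroup.subset)

lemma crossed_hom_coset_ext_incl: "crossed_hom A G coset_ext coset_ext_incl"
  by (auto simp: crossed_hom_def presheaf_map_def coset_ext_def coset_ext_incl_def intro!: homI)

text \<open>The conjugating elements \<open>(frag_of (K a), \<one>)\<close> act trivially on arrows
  and pull back to one another along every arrow, so conjugation by them commutes with pullbacks and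
  leaves the action unchanged.\<close>

lemma crossed_hom_coset_ext_conj: "crossed_hom A G coset_ext coset_ext_conj"
proof -
  have c: "coset_ext_conj a x \<in> elts coset_ext a" if "a \<in> Obj A" "x \<in> elts G a" for a x
    using that keys_diff[of "frag_of (K a)" "frag_of (translate a x (K a))"]
      K_coset[OF that(1)] translate_closed[OF that K_coset[OF that(1)]]
    by (auto simp: coset_ext_def coset_ext_conj_def keys_frag_of)
  moreover have "coset_ext_conj a (x \<otimes>\<^bsub>grp G a\<^esub> y) =
      coset_ext_conj a x \<otimes>\<^bsub>grp coset_ext a\<^esub> coset_ext_conj a y"
    if "a \<in> Obj A" "x \<in> elts G a" "y \<in> elts G a" for a x y
    using translate_mult[OF that K_coset[OF that(1)]]
    by (simp add: coset_ext_def coset_ext_conj_def)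
  moreover have "coset_ext_conj a (pull G \<phi> x) = pull coset_ext \<phi> (coset_ext_conj b x)"
    if \<phi>: "\<phi> \<in> Hom A a b" and x: "x \<in> elts G b" for a b \<phi> x
  proof -
    note O = Hom_Obj[OF \<phi>]
    interpret Ga: group "grp G a" by (rule grp[OF O(1)])
    interpret Gb: group "grp G b" by (rule grp[OF O(2)])
    \<comment> \<open>Needed for two arrows: \<open>act G x \<phi>\<close> for the first basis
      vector and, after \<open>pull_translate\<close>, \<open>\<phi>\<close> itself for the
      second.\<close>
    have "quot_pull A G K \<psi> (K b) = K a" if "\<psi> \<in> Hom A a b" for \<psi>
      using pull_coset[OF that Gb.one_closed] pull_one[OF that]
        subgroup.subset[OF K_subgroup] O by simp
    then show ?thesis
      using \<phi> act_closed[OF \<phi> x] pull_translate[OF \<phi> x K_coset[OF O(2)]]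
      by (simp add: coset_ext_def coset_ext_conj_def)
  qed
  moreover have "act coset_ext (coset_ext_conj b x) \<phi> = act G x \<phi>" for b x \<phi>
    by (simp add: coset_ext_def coset_ext_conj_def)
  ultimately show ?thesis
    by (auto simp: crossed_hom_def presheaf_map_def intro!: homI)
qed

lemma coset_ext_incl_eq_conj_iff:
  assumes a: "a \<in> Obj A" and x: "x \<in> elts G a"
  shows "coset_ext_incl a x = coset_ext_conj a x \<longleftrightarrow> x \<in> K a"
proof -
  interpret group "grp G a" by (rule grp[OF a])
  interpret Ka: subgroup "K a" "grp G a" by (rule K_subgroup[OF a])
  have "coset_ext_incl a x = coset_ext_conj a x \<longleftrightarrow> K a = translate a x (K a)"
    by (auto simp: coset_ext_incl_def coset_ext_conj_def frag_of_eq)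
  also have "\<dots> \<longleftrightarrow> inv\<^bsub>grp G a\<^esub> x \<in> K a"
    using coset_join1[OF _ inv_closed[OF x] Ka.subgroup_axioms]
      coset_join2[OF inv_closed[OF x] Ka.subgroup_axioms] by metis
  also have "\<dots> \<longleftrightarrow> x \<in> K a"
    using Ka.m_inv_closed inv_inv[OF x] by metis
  finally show ?thesis .
qed

end

text \<open>\<open>coset_ext\<close> has a different element type from the test objects in
  \<open>crossed_epi\<close>; \<open>crossed_epi_cancel\<close> bridges the gap.\<close>

theorem crossed_epi_imp_surj:
  assumes epi: "crossed_epi A P G f" and P: "crossed_group A P" and G: "crossed_group A G"
    and a: "a \<in> Obj A"
  shows "f a ` elts P a = elts G a"
proof -
  have f: "crossed_hom A P G f" using epi by (simp add: crossed_epi_def)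
  define K where "K = (\<lambda>a. f a ` elts P a)"
  interpret crossed_subgroup_cosets A G K
    using crossed_subgroup_image[OF P G f] G
    by (simp add: K_def crossed_subgroup_cosets_def crossed_subgroup_cosets_axioms_def)
  have "coset_ext_incl a y = coset_ext_conj a y" if "y \<in> elts G a" for y
    by (rule crossed_epi_cancel[OF epi G crossed_group_coset_ext crossed_hom_coset_ext_incl
          crossed_hom_coset_ext_conj _ a that])
      (use crossed_homD(2)[OF f] in \<open>simp add: coset_ext_incl_eq_conj_iff, simp add: K_def\<close>)
  then show ?thesis
    using coset_ext_incl_eq_conj_iff[OF a] crossed_homD(2)[OF f a] by (auto simp: K_def)
qed


section \<open>Goursat's lemma in one degree\<close>

text \<open>Serves for both factors: \<open>goursat_proj M Y X H\<close> puts the element of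
  \<open>Y\<close> first, and \<open>proj_swap\<close> restores the order used in
  \<open>goursat\<close>.\<close>

definition goursat_proj :: "'g monoid \<Rightarrow> 'g set \<Rightarrow> 'g set \<Rightarrow> 'g set \<Rightarrow> 'g set" where
  "goursat_proj M X Y H = {x \<in> X. \<exists>y\<in>Y. x \<otimes>\<^bsub>M\<^esub> y \<in> H}"

text \<open>Defined on arbitrary sets \<open>C\<close>; the restriction to cosets is added only in
  the family \<open>\<chi>\<close>.\<close>

definition goursat_iso :: "'g monoid \<Rightarrow> 'g set \<Rightarrow> 'g set \<Rightarrow> 'g set \<Rightarrow> 'g set" where
  "goursat_iso M Y H C = {y \<in> Y. \<exists>x\<in>C. x \<otimes>\<^bsub>M\<^esub> y \<in> H}"

text \<open>The graph of \<open>\<chi>\<close> lifted from cosets to elements and multiplied out in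
  \<open>M\<close>. The values of \<open>\<chi>\<close> are cosets, hence the relation is
  membership.\<close>

definition goursat_graph :: "'g monoid \<Rightarrow> 'g set \<Rightarrow> 'g set \<Rightarrow> ('g set \<Rightarrow> 'g set) \<Rightarrow> 'g set" where
  "goursat_graph M K N \<chi> = {x \<otimes>\<^bsub>M\<^esub> y |x y. x \<in> K \<and> y \<in> \<chi> (N #>\<^bsub>M\<^esub> x)}"

lemma goursat_graph_cong:
  "(\<And>x. x \<in> K \<Longrightarrow> \<chi> (N #>\<^bsub>M\<^esub> x) = \<chi>' (N #>\<^bsub>M\<^esub> x)) \<Longrightarrow>
    goursat_graph M K N \<chi> = goursat_graph M K N \<chi>'"
  by (auto simp: goursat_graph_def)

lemma restrict_iso_iff:
  assumes "group M"
  shows "restrict f (carrier M) \<in> iso M N \<longleftrightarrow> f \<in> iso M N"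
proof -
  interpret group M by fact
  have "bij_betw (restrict f (carrier M)) (carrier M) (carrier N) \<longleftrightarrow>
      bij_betw f (carrier M) (carrier N)"
    by (rule bij_betw_cong) simp
  then show ?thesis by (auto simp: iso_def hom_def Pi_iff)
qed

lemma r_coset_carrier_update [simp]: "N #>\<^bsub>M\<lparr>carrier := K\<rparr>\<^esub> x = N #>\<^bsub>M\<^esub> x"
  by (simp add: r_coset_def)

lemma set_mult_carrier_update [simp]: "S <#>\<^bsub>M\<lparr>carrier := K\<rparr>\<^esub> T = S <#>\<^bsub>M\<^esub> T"
  by (simp add: set_mult_def)

lemma carrier_Mod_update: "carrier (M\<lparr>carrier := K\<rparr> Mod N) = (\<lambda>x. N #>\<^bsub>M\<^esub> x) ` K"
  by (simp add: carrier_FactGroup)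

section \<open>Internal direct products of two commuting subgroups\<close>

locale commuting_subgroups = group M for M :: "'g monoid" (structure) +
  fixes X Y :: "'g set"
  assumes X: "subgroup X M" and Y: "subgroup Y M"
    and comm: "x \<in> X \<Longrightarrow> y \<in> Y \<Longrightarrow> x \<otimes> y = y \<otimes> x"
    and triv: "X \<inter> Y = {\<one>}"
begin

lemma swap: "commuting_subgroups M Y X"
  using X Y comm triv
  by (intro commuting_subgroups.intro commuting_subgroups_axioms.intro is_group) auto

lemma X_closed [simp]: "x \<in> X \<Longrightarrow> x \<in> carrier M" and Y_closed [simp]: "y \<in> Y \<Longrightarrow> y \<in> carrier M"
  using subgroup.subset[OF X] subgroup.subset[OF Y] by auto

lemma X_ops [simp]: "\<one> \<in> X" "x \<in> X \<Longrightarrow> x' \<in> X \<Longrightarrow> x \<otimes> x' \<in> X" "x \<in> X \<Longrightarrow> inv x \<in> X"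
  and Y_ops [simp]: "\<one> \<in> Y" "y \<in> Y \<Longrightarrow> y' \<in> Y \<Longrightarrow> y \<otimes> y' \<in> Y" "y \<in> Y \<Longrightarrow> inv y \<in> Y"
  using X Y by (auto simp: subgroup.one_closed subgroup.m_closed subgroup.m_inv_closed)

lemma mult_mult:
  assumes "x \<in> X" "y \<in> Y" "x' \<in> X" "y' \<in> Y"
  shows "(x \<otimes> y) \<otimes> (x' \<otimes> y') = (x \<otimes> x') \<otimes> (y \<otimes> y')"
proof -
  have "(x \<otimes> y) \<otimes> (x' \<otimes> y') = x \<otimes> (y \<otimes> x') \<otimes> y'" using assms by (simp add: m_assoc)
  also have "y \<otimes> x' = x' \<otimes> y" using assms comm[of x' y] by simp
  also have "x \<otimes> (x' \<otimes> y) \<otimes> y' = (x \<otimes> x') \<otimes> (y \<otimes> y')" using assms by (simp add: m_assoc)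
  finally show ?thesis .
qed

lemma inv_mult: "x \<in> X \<Longrightarrow> y \<in> Y \<Longrightarrow> inv (x \<otimes> y) = inv x \<otimes> inv y"
  using comm[of "inv x" "inv y"] by (simp add: inv_mult_group)

lemma mult_inv_mult:
  "x \<in> X \<Longrightarrow> y \<in> Y \<Longrightarrow> x' \<in> X \<Longrightarrow> y' \<in> Y \<Longrightarrow>
    (x \<otimes> y) \<otimes> inv (x' \<otimes> y') = (x \<otimes> inv x') \<otimes> (y \<otimes> inv y')"
  using mult_mult[of x y "inv x'" "inv y'"] by (simp add: inv_mult)

lemma mult_eq_one:
  assumes "x \<in> X" "y \<in> Y" "x \<otimes> y = \<one>" shows "x = \<one> \<and> y = \<one>"
proof -
  have "inv y = x" using assms by (intro inv_equality) auto
  then have "x \<in> Y" using assms by auto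
  then have "x = \<one>" using assms triv by auto
  then show ?thesis using assms by simp
qed

text \<open>Because the factors commute, the quotient of the two products is again a product of
  components, and a trivial product has trivial components since \<open>X\<close> and
  \<open>Y\<close> meet trivially.\<close>

lemma mult_unique:
  assumes "x \<in> X" "y \<in> Y" "x' \<in> X" "y' \<in> Y" "x \<otimes> y = x' \<otimes> y'"
  shows "x = x' \<and> y = y'"
proof -
  have "(x \<otimes> inv x') \<otimes> (y \<otimes> inv y') = \<one>"
    using assms mult_inv_mult[of x y x' y'] by simp
  then have "x \<otimes> inv x' = \<one> \<and> y \<otimes> inv y' = \<one>" using assms by (intro mult_eq_one) auto
  then show ?thesis using assms by (metis X_closed Y_closed inv_equality inv_inv inv_closed)
qed

lemma proj_swap: "goursat_proj M Y X H = {y \<in> Y. \<exists>x\<in>X. x \<otimes> y \<in> H}"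
  using comm by (auto simp: goursat_proj_def)

lemma subset_set_mult: "X \<subseteq> X <#> Y" "Y \<subseteq> X <#> Y"
proof -
  have m: "x \<otimes> y \<in> X <#> Y" if "x \<in> X" "y \<in> Y" for x y
    using that unfolding set_mult_def by blast
  show "X \<subseteq> X <#> Y" using m[OF _ Y_ops(1)] by auto
  show "Y \<subseteq> X <#> Y" using m[OF X_ops(1)] by auto
qed

text \<open>Later confines the image of the coproduct to products of one element from each
  factor.\<close>

lemma subgroup_set_mult: "subgroup (X <#> Y) M"
proof (intro subgroupI)
  show "X <#> Y \<subseteq> carrier M" by (auto simp: set_mult_def)
  show "X <#> Y \<noteq> {}" using X_ops(1) Y_ops(1) unfolding set_mult_def by blast
next
  fix h assume "h \<in> X <#> Y"
  then obtain x y where "x \<in> X" "y \<in> Y" "h = x \<otimes> y" by (auto simp: set_mult_def)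
  then have "inv x \<in> X" "inv y \<in> Y" "inv h = inv x \<otimes> inv y" by (simp_all add: inv_mult)
  then show "inv h \<in> X <#> Y" by (auto simp: set_mult_def)
next
  fix h h' assume "h \<in> X <#> Y" "h' \<in> X <#> Y"
  then obtain x y x' y' where xy: "x \<in> X" "y \<in> Y" "h = x \<otimes> y" "x' \<in> X" "y' \<in> Y" "h' = x' \<otimes> y'"
    by (auto simp: set_mult_def)
  then have "h \<otimes> h' = (x \<otimes> x') \<otimes> (y \<otimes> y')" by (simp only: mult_mult)
  then show "h \<otimes> h' \<in> X <#> Y" using xy X_ops(2)[of x x'] Y_ops(2)[of y y'] unfolding set_mult_def by blast
qed

end

section \<open>From a subgroup to an isomorphism of quotients\<close>

locale goursat_subgroup = commuting_subgroups +
  fixes H :: "'a set"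
  assumes H: "subgroup H M"
begin

lemma swap_subgroup: "goursat_subgroup M Y X H"
  using swap H by (simp add: goursat_subgroup_def goursat_subgroup_axioms_def)

lemma H_closed [simp]: "h \<in> H \<Longrightarrow> h \<in> carrier M"
  using subgroup.subset[OF H] by auto

lemma H_ops [simp]: "\<one> \<in> H" "x \<in> H \<Longrightarrow> x' \<in> H \<Longrightarrow> x \<otimes> x' \<in> H" "x \<in> H \<Longrightarrow> inv x \<in> H"
  using H by (auto simp: subgroup.one_closed subgroup.m_closed subgroup.m_inv_closed)

lemma H_mult_cancel [simp]:
  "h \<in> H \<Longrightarrow> x \<in> carrier M \<Longrightarrow> h \<otimes> x \<in> H \<longleftrightarrow> x \<in> H"
  using H_ops(2)[of "inv h" "h \<otimes> x"] by (auto simp: m_assoc[symmetric])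

lemma proj_subgroup: "subgroup (goursat_proj M X Y H) M"
proof (intro subgroupI)
  show "goursat_proj M X Y H \<noteq> {}"
    by (auto simp: goursat_proj_def intro!: exI[of _ \<one>] bexI[of _ \<one>])
next
  fix x assume "x \<in> goursat_proj M X Y H"
  then obtain y where "x \<in> X" "y \<in> Y" "x \<otimes> y \<in> H" by (auto simp: goursat_proj_def)
  then show "inv x \<in> goursat_proj M X Y H"
    using H_ops(3)[of "x \<otimes> y"] by (auto simp: goursat_proj_def inv_mult intro!: bexI[of _ "inv y"])
next
  fix x x' assume "x \<in> goursat_proj M X Y H" "x' \<in> goursat_proj M X Y H"
  then obtain y y' where "x \<in> X" "y \<in> Y" "x \<otimes> y \<in> H" "x' \<in> X" "y' \<in> Y" "x' \<otimes> y' \<in> H"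
    by (auto simp: goursat_proj_def)
  then show "x \<otimes> x' \<in> goursat_proj M X Y H"
    using H_ops(2)[of "x \<otimes> y" "x' \<otimes> y'"]
    by (auto simp: goursat_proj_def mult_mult intro!: bexI[of _ "y \<otimes> y'"])
qed (auto simp: goursat_proj_def)

lemma Int_subset_proj: "H \<inter> X \<subseteq> goursat_proj M X Y H"
  by (auto simp: goursat_proj_def intro!: bexI[of _ \<one>])

lemma Int_subgroup: "subgroup (H \<inter> X) (M\<lparr>carrier := goursat_proj M X Y H\<rparr>)"
  by (rule subgroup_incl[OF subgroups_Inter_pair[OF H X] proj_subgroup Int_subset_proj])

lemma Int_normal: "H \<inter> X \<lhd> M\<lparr>carrier := goursat_proj M X Y H\<rparr>"
proof -
  interpret P: group "M\<lparr>carrier := goursat_proj M X Y H\<rparr>"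
    by (rule subgroup_imp_group[OF proj_subgroup])
  have "x \<otimes> n \<otimes> inv x \<in> H \<inter> X" if x: "x \<in> goursat_proj M X Y H" and n: "n \<in> H \<inter> X" for x n
  proof -
    from x obtain y where y: "x \<in> X" "y \<in> Y" "x \<otimes> y \<in> H" by (auto simp: goursat_proj_def)
    \<comment> \<open>With \<open>n\<close> written as \<open>n \<otimes> \<one>\<close>, the
      partner \<open>y\<close> cancels: conjugating \<open>n\<close> by \<open>x\<close> is the same
      as conjugating it by \<open>x \<otimes> y\<close>, which lies in \<open>H\<close>.\<close>
    have "(x \<otimes> y) \<otimes> (n \<otimes> \<one>) \<otimes> inv (x \<otimes> y) = (x \<otimes> n \<otimes> inv x) \<otimes> (y \<otimes> \<one> \<otimes> inv y)"
      using y n mult_mult[of x y n \<one>] mult_inv_mult[of "x \<otimes> n" "y \<otimes> \<one>" x y] by simp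
    then have "(x \<otimes> y) \<otimes> n \<otimes> inv (x \<otimes> y) = x \<otimes> n \<otimes> inv x" using y n by simp
    moreover have "(x \<otimes> y) \<otimes> n \<otimes> inv (x \<otimes> y) \<in> H"
      using H_ops(2)[OF H_ops(2)[OF y(3), of n] H_ops(3)[OF y(3)]] n by blast
    ultimately show ?thesis using y n by auto
  qed
  then show ?thesis
    using Int_subgroup m_inv_consistent[OF proj_subgroup] by (simp add: P.normal_inv_iff)
qed

text \<open>Two partners \<open>y\<close>, \<open>z\<close> of \<open>x\<close> differ by an element
  of \<open>H \<inter> Y\<close>, because the components from \<open>X\<close> cancel in the
  quotient of \<open>x \<otimes> z\<close> by \<open>x \<otimes> y\<close>. Thus any single partner
  determines the value.\<close>

lemma goursat_iso_coset:
  assumes x: "x \<in> X" and y: "y \<in> Y" and xy: "x \<otimes> y \<in> H"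
  shows "goursat_iso M Y H ((H \<inter> X) #> x) = (H \<inter> Y) #> y"
proof (intro equalityI subsetI)
  fix z assume "z \<in> goursat_iso M Y H ((H \<inter> X) #> x)"
  then obtain n where z: "z \<in> Y" and n: "n \<in> H" "n \<in> X" "n \<otimes> x \<otimes> z \<in> H"
    by (auto simp: goursat_iso_def r_coset_def)
  have "x \<otimes> z \<in> H" using n x z by (simp add: m_assoc)
  then have "(x \<otimes> z) \<otimes> inv (x \<otimes> y) \<in> H" using xy by simp
  then have "z \<otimes> inv y \<in> H" using x y z by (simp add: mult_inv_mult)
  moreover have "z = (z \<otimes> inv y) \<otimes> y" using y z by (simp add: m_assoc)
  ultimately show "z \<in> (H \<inter> Y) #> y" using y z by (auto simp: r_coset_def)
next
  fix z assume "z \<in> (H \<inter> Y) #> y"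
  then obtain n where n: "n \<in> H" "n \<in> Y" and z: "z = n \<otimes> y" by (auto simp: r_coset_def)
  have "\<one> \<otimes> x \<otimes> z = n \<otimes> (x \<otimes> y)"
    using mult_mult[of \<one> n x y] x y n z by simp
  then have "\<one> \<otimes> x \<otimes> z \<in> H" using n xy by simp
  then show "z \<in> goursat_iso M Y H ((H \<inter> X) #> x)"
    using n y z by (auto simp: goursat_iso_def r_coset_def)
qed

text \<open>The inverse is the same formula with the factors exchanged,
  \<open>goursat_iso M X H\<close>. Multiplicativity holds because the product of partners of
  \<open>x\<close> and \<open>x'\<close> is a partner of \<open>x \<otimes> x'\<close>.\<close>

lemma goursat_iso_iso:
  "goursat_iso M Y H \<in> iso (M\<lparr>carrier := goursat_proj M X Y H\<rparr> Mod (H \<inter> X))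
    (M\<lparr>carrier := goursat_proj M Y X H\<rparr> Mod (H \<inter> Y))"
proof -
  interpret S: goursat_subgroup M Y X H by (rule swap_subgroup)
  interpret N: normal "H \<inter> X" "M\<lparr>carrier := goursat_proj M X Y H\<rparr>" by (rule Int_normal)
  interpret N': normal "H \<inter> Y" "M\<lparr>carrier := goursat_proj M Y X H\<rparr>" by (rule S.Int_normal)
  let ?C = "\<lambda>x. (H \<inter> X) #> x" and ?D = "\<lambda>y. (H \<inter> Y) #> y"
  have ex: "\<exists>y. y \<in> goursat_proj M Y X H \<and> goursat_iso M Y H (?C x) = ?D y \<and>
      goursat_iso M X H (?D y) = ?C x \<and> x \<in> X \<and> y \<in> Y \<and> x \<otimes> y \<in> H"
    if "x \<in> goursat_proj M X Y H" for x
  proof -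
    from that obtain y where y: "x \<in> X" "y \<in> Y" "x \<otimes> y \<in> H" by (auto simp: goursat_proj_def)
    moreover have "y \<otimes> x \<in> H" using y comm[of x y] by simp
    ultimately show ?thesis
      using goursat_iso_coset[of x y] S.goursat_iso_coset[of y x] by (auto simp: goursat_proj_def)
  qed
  have ex': "\<exists>x. x \<in> goursat_proj M X Y H \<and> goursat_iso M Y H (?C x) = ?D y \<and>
      goursat_iso M X H (?D y) = ?C x"
    if "y \<in> goursat_proj M Y X H" for y
  proof -
    from that obtain x where y: "x \<in> X" "y \<in> Y" "y \<otimes> x \<in> H" by (auto simp: goursat_proj_def)
    moreover have "x \<otimes> y \<in> H" using y comm[of x y] by simp
    ultimately show ?thesis
      using goursat_iso_coset[of x y] S.goursat_iso_coset[of y x] by (auto simp: goursat_proj_def)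
  qed
  have bij: "bij_betw (goursat_iso M Y H) (?C ` goursat_proj M X Y H) (?D ` goursat_proj M Y X H)"
    by (rule bij_betw_byWitness[where f' = "goursat_iso M X H"]) (use ex ex' in force)+
  have "goursat_iso M Y H (?C x <#> ?C x') = goursat_iso M Y H (?C x) <#> goursat_iso M Y H (?C x')"
    if x: "x \<in> goursat_proj M X Y H" and x': "x' \<in> goursat_proj M X Y H" for x x'
  proof -
    obtain y where y: "y \<in> goursat_proj M Y X H" "goursat_iso M Y H (?C x) = ?D y"
      "x \<in> X" "y \<in> Y" "x \<otimes> y \<in> H" using ex[OF x] by blast
    obtain y' where y': "y' \<in> goursat_proj M Y X H" "goursat_iso M Y H (?C x') = ?D y'"
      "x' \<in> X" "y' \<in> Y" "x' \<otimes> y' \<in> H" using ex[OF x'] by blast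
    have "(x \<otimes> x') \<otimes> (y \<otimes> y') \<in> H"
      using y y' H_ops(2)[of "x \<otimes> y" "x' \<otimes> y'"] by (simp add: mult_mult)
    then have "goursat_iso M Y H (?C (x \<otimes> x')) = ?D (y \<otimes> y')"
      using y y' by (intro goursat_iso_coset) auto
    then show ?thesis
      using N.rcos_sum[of x x'] N'.rcos_sum[of y y'] x x' y y' by simp
  qed
  moreover have "goursat_iso M Y H (?C x) \<in> ?D ` goursat_proj M Y X H"
    if "x \<in> goursat_proj M X Y H" for x
    using ex[OF that] by auto
  ultimately show ?thesis
    using bij by (auto simp: iso_def carrier_Mod_update intro!: homI)
qed

text \<open>The graph contains only products of the two factors, so the assumption guarantees that
  no element of \<open>H\<close> is lost.\<close>

lemma goursat_graph_goursat:
  assumes "H \<subseteq> X <#> Y"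
  shows "goursat_graph M (goursat_proj M X Y H) (H \<inter> X) (goursat_iso M Y H) = H"
proof (intro equalityI subsetI)
  fix h assume "h \<in> goursat_graph M (goursat_proj M X Y H) (H \<inter> X) (goursat_iso M Y H)"
  then obtain x y where h: "h = x \<otimes> y" "x \<in> X" and "y \<in> goursat_iso M Y H ((H \<inter> X) #> x)"
    by (auto simp: goursat_graph_def goursat_proj_def)
  then obtain n where "y \<in> Y" "n \<in> H" "n \<in> X" "n \<otimes> x \<otimes> y \<in> H"
    by (auto simp: goursat_iso_def r_coset_def)
  then show "h \<in> H" using h by (simp add: m_assoc)
next
  fix h assume h: "h \<in> H"
  then obtain x y where xy: "h = x \<otimes> y" "x \<in> X" "y \<in> Y"
    using assms by (auto simp: set_mult_def)
  have "x \<in> (H \<inter> X) #> x"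
    using xy by (intro rcos_self subgroups_Inter_pair H X) auto
  then show "h \<in> goursat_graph M (goursat_proj M X Y H) (H \<inter> X) (goursat_iso M Y H)"
    using xy h by (auto simp: goursat_graph_def goursat_proj_def goursat_iso_def)
qed

end

section \<open>From an isomorphism of quotients to a subgroup\<close>

locale goursat_quintuple = commuting_subgroups +
  fixes K1 N1 K2 N2 :: "'a set" and \<chi> :: "'a set \<Rightarrow> 'a set"
  assumes K1: "subgroup K1 M" "K1 \<subseteq> X" and N1: "N1 \<lhd> M\<lparr>carrier := K1\<rparr>"
    and K2: "subgroup K2 M" "K2 \<subseteq> Y" and N2: "N2 \<lhd> M\<lparr>carrier := K2\<rparr>"
    and \<chi>: "\<chi> \<in> iso (M\<lparr>carrier := K1\<rparr> Mod N1) (M\<lparr>carrier := K2\<rparr> Mod N2)"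
begin

sublocale N1: normal N1 "M\<lparr>carrier := K1\<rparr>" by (rule N1)
sublocale N2: normal N2 "M\<lparr>carrier := K2\<rparr>" by (rule N2)

lemma K1_ops [simp]: "\<one> \<in> K1" "x \<in> K1 \<Longrightarrow> x' \<in> K1 \<Longrightarrow> x \<otimes> x' \<in> K1" "x \<in> K1 \<Longrightarrow> inv x \<in> K1"
    "x \<in> K1 \<Longrightarrow> x \<in> X" "x \<in> K1 \<Longrightarrow> x \<in> carrier M"
  and K2_ops [simp]: "\<one> \<in> K2" "y \<in> K2 \<Longrightarrow> y' \<in> K2 \<Longrightarrow> y \<otimes> y' \<in> K2" "y \<in> K2 \<Longrightarrow> inv y \<in> K2"
    "y \<in> K2 \<Longrightarrow> y \<in> Y" "y \<in> K2 \<Longrightarrow> y \<in> carrier M"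
  using K1 K2 by (auto simp: subgroup.one_closed subgroup.m_closed subgroup.m_inv_closed)

lemma N_subset: "N1 \<subseteq> K1" "N2 \<subseteq> K2"
  using N1.subset N2.subset by auto

lemma N_subgroup: "subgroup N1 M" "subgroup N2 M"
  using incl_subgroup[OF K1(1) N1.subgroup_axioms] incl_subgroup[OF K2(1) N2.subgroup_axioms] by auto

lemma mem_coset_self [simp]: "y \<in> K2 \<Longrightarrow> y \<in> N2 #> y"
  using rcos_self[OF _ N_subgroup(2)] by simp

lemma coset_eq_iff:
  "y \<in> K2 \<Longrightarrow> z \<in> K2 \<Longrightarrow> N2 #> y = N2 #> z \<longleftrightarrow> z \<in> N2 #> y"
  using repr_independence[OF _ _ N_subgroup(2)] rcos_self[OF _ N_subgroup(2)] by (metis K2_ops(5))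

lemma chi_coset:
  assumes "x \<in> K1" obtains y where "y \<in> K2" "\<chi> (N1 #> x) = N2 #> y"
proof -
  have "\<chi> (N1 #> x) \<in> (\<lambda>y. N2 #> y) ` K2"
    using \<chi> assms by (auto simp: iso_def hom_def carrier_Mod_update)
  then show ?thesis using that by blast
qed

text \<open>Passes between \<open>\<chi>\<close> as a relation on elements, which defines the graph,
  and \<open>\<chi>\<close> as a map of cosets, to which the homomorphism laws apply.\<close>

lemma mem_chi_iff: "x \<in> K1 \<Longrightarrow> y \<in> \<chi> (N1 #> x) \<longleftrightarrow> y \<in> K2 \<and> \<chi> (N1 #> x) = N2 #> y"
proof (erule chi_coset)
  fix z assume z: "z \<in> K2" "\<chi> (N1 #> x) = N2 #> z"
  have "N2 #> z \<subseteq> K2" using z N_subset by (auto simp: r_coset_def)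
  then show "y \<in> \<chi> (N1 #> x) \<longleftrightarrow> y \<in> K2 \<and> \<chi> (N1 #> x) = N2 #> y"
    using z coset_eq_iff[of z y] by auto
qed

lemma chi_mult:
  assumes "x \<in> K1" "x' \<in> K1" "y \<in> \<chi> (N1 #> x)" "y' \<in> \<chi> (N1 #> x')"
  shows "y \<otimes> y' \<in> \<chi> (N1 #> (x \<otimes> x'))"
proof -
  have "\<chi> ((N1 #> x) <#> (N1 #> x')) = \<chi> (N1 #> x) <#> \<chi> (N1 #> x')"
    using \<chi> assms by (auto simp: iso_def hom_def carrier_Mod_update)
  then show ?thesis
    using assms N1.rcos_sum[of x x'] N2.rcos_sum[of y y'] by (simp add: mem_chi_iff)
qed

lemma chi_one: "\<chi> N1 = N2"
proof -
  have "\<chi> \<one>\<^bsub>M\<lparr>carrier := K1\<rparr> Mod N1\<^esub> = \<one>\<^bsub>M\<lparr>carrier := K2\<rparr> Mod N2\<^esub>"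
    using \<chi> by (intro hom_one N1.factorgroup_is_group N2.factorgroup_is_group) (simp add: iso_def)
  then show ?thesis by simp
qed

lemma chi_inv:
  assumes "x \<in> K1" "y \<in> \<chi> (N1 #> x)"
  shows "inv y \<in> \<chi> (N1 #> inv x)"
proof -
  have y: "y \<in> K2" using assms mem_chi_iff by blast
  obtain z where z: "z \<in> K2" "\<chi> (N1 #> inv x) = N2 #> z" using chi_coset assms K1_ops(3) by metis
  then have "z \<in> \<chi> (N1 #> inv x)" using mem_chi_iff assms by simp
  then have "y \<otimes> z \<in> N2"
    using chi_mult[OF assms(1) _ assms(2), of "inv x" z] assms(1) chi_one
      subgroup.subset[OF N_subgroup(1)] by simp
  then have "inv (y \<otimes> z) \<in> N2" by (rule subgroup.m_inv_closed[OF N_subgroup(2)])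
  then have "inv z \<otimes> inv y \<in> N2" using y z by (simp add: inv_mult_group)
  \<comment> \<open>Conjugating by \<open>z\<close> moves \<open>inv z\<close> to the right, as
    membership of \<open>inv y\<close> in the right coset \<open>N2 #> z\<close> requires.\<close>
  then have "z \<otimes> (inv z \<otimes> inv y) \<otimes> inv z \<in> N2"
    using N2.inv_op_closed2[of z "inv z \<otimes> inv y"] z m_inv_consistent[OF K2(1), of z] by simp
  moreover have "z \<otimes> (inv z \<otimes> inv y) \<otimes> inv z = inv y \<otimes> inv z"
    using y z by (simp add: m_assoc[symmetric])
  ultimately have "(inv y \<otimes> inv z) \<otimes> z \<in> N2 #> z" by (auto simp: r_coset_def)
  then show ?thesis using y z by (simp add: m_assoc)
qed

abbreviation graph :: "'a set" where "graph \<equiv> goursat_graph M K1 N1 \<chi>"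

lemma mult_mem_graph_iff:
  assumes "x \<in> X" "y \<in> Y"
  shows "x \<otimes> y \<in> graph \<longleftrightarrow> x \<in> K1 \<and> y \<in> \<chi> (N1 #> x)"
proof
  assume "x \<otimes> y \<in> graph"
  then obtain x' y' where "x \<otimes> y = x' \<otimes> y'" "x' \<in> K1" "y' \<in> \<chi> (N1 #> x')"
    by (auto simp: goursat_graph_def)
  then show "x \<in> K1 \<and> y \<in> \<chi> (N1 #> x)"
    using mult_unique[of x y x' y'] assms mem_chi_iff by auto
qed (auto simp: goursat_graph_def)

lemma graphE:
  assumes "h \<in> graph"
  obtains x y where "h = x \<otimes> y" "x \<in> K1" "y \<in> K2" "y \<in> \<chi> (N1 #> x)"
  using assms mem_chi_iff by (auto simp: goursat_graph_def)

lemma graph_subgroup: "subgroup graph M"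
proof (intro subgroupI)
  have "\<one> \<in> \<chi> (N1 #> \<one>)"
    using chi_one subgroup.subset[OF N_subgroup(1)] subgroup.one_closed[OF N_subgroup(2)] by simp
  then show "graph \<noteq> {}" using mult_mem_graph_iff[of \<one> \<one>] by auto
next
  fix h assume "h \<in> graph"
  then obtain x y where "h = x \<otimes> y" "x \<in> K1" "y \<in> K2" "y \<in> \<chi> (N1 #> x)" by (rule graphE)
  then show "inv h \<in> graph" using chi_inv by (simp add: inv_mult mult_mem_graph_iff)
next
  fix h h' assume "h \<in> graph" "h' \<in> graph"
  then obtain x y x' y' where "h = x \<otimes> y" "x \<in> K1" "y \<in> K2" "y \<in> \<chi> (N1 #> x)"
    "h' = x' \<otimes> y'" "x' \<in> K1" "y' \<in> K2" "y' \<in> \<chi> (N1 #> x')" by (metis graphE)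
  then show "h \<otimes> h' \<in> graph" using chi_mult by (simp add: mult_mult mult_mem_graph_iff)
qed (auto elim!: graphE)

lemma proj_graph: "goursat_proj M X Y graph = K1"
proof -
  have "\<exists>y\<in>Y. y \<in> \<chi> (N1 #> x)" if "x \<in> K1" for x
    using chi_coset[OF that] mem_chi_iff[OF that] by (metis K2_ops(4))
  then show ?thesis by (auto simp: goursat_proj_def mult_mem_graph_iff)
qed

text \<open>Surjectivity of \<open>\<chi>\<close> supplies a partner for each element of
  \<open>K2\<close>.\<close>

lemma proj_swap_graph: "goursat_proj M Y X graph = K2"
proof -
  have "\<exists>x\<in>X. x \<in> K1 \<and> y \<in> \<chi> (N1 #> x)" if "y \<in> K2" for y
  proof -
    have "N2 #> y \<in> \<chi> ` (\<lambda>x. N1 #> x) ` K1"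
      using \<chi> that by (auto simp: iso_def bij_betw_def carrier_Mod_update)
    then show ?thesis using mem_chi_iff that by (metis K1_ops(4) imageE)
  qed
  then show ?thesis using mem_chi_iff by (auto simp: proj_swap mult_mem_graph_iff)
qed

text \<open>Writing \<open>x\<close> as \<open>x \<otimes> \<one>\<close> gives the condition that
  \<open>\<chi>\<close> takes the same value on \<open>N1 #> x\<close> and on \<open>N1\<close>;
  injectivity of \<open>\<chi>\<close> turns it into membership in \<open>N1\<close>.\<close>

lemma graph_Int: "graph \<inter> X = N1"
proof -
  have "x \<in> graph \<longleftrightarrow> x \<in> N1" if x: "x \<in> X" for x
  proof -
    have "x \<in> graph \<longleftrightarrow> x \<in> K1 \<and> \<chi> (N1 #> x) = \<chi> N1"
      using mult_mem_graph_iff[of x \<one>] x mem_chi_iff[of x \<one>] chi_one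
        subgroup.subset[OF N_subgroup(2)] by auto
    also have "\<dots> \<longleftrightarrow> x \<in> K1 \<and> N1 #> x = N1"
    proof -
      have "inj_on \<chi> ((\<lambda>x. N1 #> x) ` K1)"
        using \<chi> by (auto simp: iso_def bij_betw_def carrier_Mod_update)
      moreover have "N1 \<in> (\<lambda>x. N1 #> x) ` K1"
        using subgroup.subset[OF N_subgroup(1)] by (intro image_eqI[of _ _ \<one>]) auto
      ultimately show ?thesis by (auto dest: inj_onD)
    qed
    also have "\<dots> \<longleftrightarrow> x \<in> N1"
      using N_subset coset_join1[of N1 x] coset_join2[of x N1] N_subgroup x by auto
    finally show ?thesis .
  qed
  then show ?thesis using N_subset K1(2) by auto
qed

lemma graph_Int_swap: "graph \<inter> Y = N2"
proof -
  have "y \<in> graph \<longleftrightarrow> y \<in> N2" if "y \<in> Y" for y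
    using mult_mem_graph_iff[of \<one> y] that chi_one subgroup.subset[OF N_subgroup(1)] by simp
  then show ?thesis using N_subset K2(2) by auto
qed

text \<open>Every representative of \<open>C\<close> gives the same coset, so the existential over
  \<open>C\<close> in \<open>goursat_iso\<close> collapses to membership in
  \<open>\<chi> C\<close>.\<close>

lemma goursat_iso_graph:
  assumes "C \<in> (\<lambda>x. N1 #> x) ` K1"
  shows "goursat_iso M Y graph C = \<chi> C"
proof -
  from assms obtain x where x: "x \<in> K1" "C = N1 #> x" by blast
  have C: "N1 #> z = C \<and> z \<in> K1" if "z \<in> C" for z
    using repr_independence[of z N1 x] that x N_subset N_subgroup by (auto simp: r_coset_def)
  have xC: "x \<in> C" using x N_subgroup(1) by (simp add: rcos_self)
  have "\<chi> C \<subseteq> Y" using mem_chi_iff[OF x(1)] x by auto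
  then show ?thesis
    using C xC by (auto simp: goursat_iso_def mult_mem_graph_iff intro!: bexI[of _ x])
qed

end


section \<open>Goursat's lemma for virtual products\<close>

lemma crossed_subgroup_sub_iff:
  assumes G: "crossed_group A G" and K: "crossed_subgroup A G K"
  shows "crossed_subgroup A (sub G K) N \<longleftrightarrow>
    crossed_subgroup A G N \<and> (\<forall>a\<in>Obj A. N a \<subseteq> K a)"
proof -
  interpret crossed_group A G by (rule G)
  have "subgroup (N a) (grp (sub G K) a) \<longleftrightarrow> subgroup (N a) (grp G a) \<and> N a \<subseteq> K a"
    if a: "a \<in> Obj A" for a
  proof -
    interpret group "grp G a" by (rule grp[OF a])
    have Ka: "subgroup (K a) (grp G a)" using K a by (simp add: crossed_subgroup_def)
    then show ?thesis
      using incl_subgroup[OF Ka, of "N a"] subgroup_incl[of "N a" "K a"]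
        subgroup.subset[of "N a" "(grp G a)\<lparr>carrier := K a\<rparr>"]
      by (auto simp: sub_def)
  qed
  then show ?thesis by (auto simp: crossed_subgroup_def sub_def)
qed

lemma quot_grp_sub: "quot_grp (sub G K) N a = (grp G a)\<lparr>carrier := K a\<rparr> Mod N a"
  by (simp add: quot_grp_def sub_def)

lemma quot_pull_sub:
  assumes "crossed_group A G" "crossed_subgroup A G K" "crossed_subgroup A (sub G K) N"
    and "\<And>a. a \<in> Obj A \<Longrightarrow> N a \<lhd> grp (sub G K) a"
    and "\<phi> \<in> Hom A a b" "x \<in> K b"
  shows "quot_pull A (sub G K) N \<phi> (N b #>\<^bsub>grp G b\<^esub> x) = N a #>\<^bsub>grp G a\<^esub> pull G \<phi> x"
  using quot_pull_coset[OF crossed_group_sub[OF assms(1,2)] assms(3-5), of x] assms(6)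
  by (simp add: sub_def)

section \<open>Virtual products as degreewise direct products\<close>

locale virtual_product_crossed_group = crossed_group A G
  for A :: "('o, 'm) cat" and G :: "('o, 'm, 'g) crossed" +
  fixes G1 G2 :: "'o \<Rightarrow> 'g set"
  assumes G1: "crossed_subgroup A G G1" and G2: "crossed_subgroup A G G2"
    and virtual_product: "virtual_product A G G1 G2"
begin

lemma crossed_group_G: "crossed_group A G" by unfold_locales

lemma commuting:
  assumes a: "a \<in> Obj A" shows "commuting_subgroups (grp G a) (G1 a) (G2 a)"
proof -
  interpret group "grp G a" by (rule grp[OF a])
  have s: "subgroup (G1 a) (grp G a)" "subgroup (G2 a) (grp G a)"
    using G1 G2 a by (auto simp: crossed_subgroup_def)
  have "x \<otimes>\<^bsub>grp G a\<^esub> y = y \<otimes>\<^bsub>grp G a\<^esub> x" if xy: "x \<in> G1 a" "y \<in> G2 a" for x y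
  proof -
    have c: "x \<in> elts G a" "y \<in> elts G a" using s xy subgroup.mem_carrier by fast+
    have "x \<otimes>\<^bsub>grp G a\<^esub> y \<otimes>\<^bsub>grp G a\<^esub> inv\<^bsub>grp G a\<^esub> x \<otimes>\<^bsub>grp G a\<^esub> inv\<^bsub>grp G a\<^esub> y
        \<in> commutator_subgroup (grp G a) (G1 a) (G2 a)"
      unfolding commutator_subgroup_def using xy by (intro generate.incl) blast
    then have "x \<otimes>\<^bsub>grp G a\<^esub> y \<otimes>\<^bsub>grp G a\<^esub> inv\<^bsub>grp G a\<^esub> x \<otimes>\<^bsub>grp G a\<^esub> inv\<^bsub>grp G a\<^esub> y = \<one>\<^bsub>grp G a\<^esub>"
      using virtual_product a by (simp add: virtual_product_def)
    then have "(x \<otimes>\<^bsub>grp G a\<^esub> y) \<otimes>\<^bsub>grp G a\<^esub> inv\<^bsub>grp G a\<^esub> (y \<otimes>\<^bsub>grp G a\<^esub> x) = \<one>\<^bsub>grp G a\<^esub>"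
      using c by (simp add: inv_mult_group m_assoc)
    then show ?thesis using c by (metis inv_equality inv_inv inv_closed m_closed)
  qed
  moreover have "G1 a \<inter> G2 a = {\<one>\<^bsub>grp G a\<^esub>}"
    using virtual_product a by (simp add: virtual_product_def)
  ultimately show ?thesis
    using s by (intro commuting_subgroups.intro commuting_subgroups_axioms.intro is_group)
qed

lemma set_mult_eq:
  assumes a: "a \<in> Obj A" shows "G1 a <#>\<^bsub>grp G a\<^esub> G2 a = elts G a"
proof -
  interpret commuting_subgroups "grp G a" "G1 a" "G2 a" by (rule commuting[OF a])
  interpret S: subgroup "G1 a <#>\<^bsub>grp G a\<^esub> G2 a" "grp G a" by (rule subgroup_set_mult)
  let ?P = "coprod A (sub G G1) (sub G G2)" and ?f = "copair G (\<lambda>a x. x) (\<lambda>a y. y)"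
  have s: "crossed_group A (sub G G1)" "crossed_group A (sub G G2)"
    using crossed_group_sub[OF crossed_group_G] G1 G2 by auto
  have "two_crossed_groups A (sub G G1) (sub G G2)" using s by (rule two_crossed_groups.intro)
  then have "crossed_group A ?P" by (rule two_crossed_groups.crossed_group_coprod)
  then have surj: "?f a ` elts ?P a = elts G a"
    using virtual_product crossed_group_G a by (intro crossed_epi_imp_surj) (auto simp: virtual_product_def)
  have "?f a w \<in> G1 a <#>\<^bsub>grp G a\<^esub> G2 a" if "w \<in> elts ?P a" for w
  proof -
    \<comment> \<open>Reducedness is dropped: the induction needs only that each letter maps into
      the subgroup of products.\<close>
    have "set w \<subseteq> letters ((grp G a)\<lparr>carrier := G1 a\<rparr>) ((grp G a)\<lparr>carrier := G2 a\<rparr>)"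
      using that reduced_words_letters by (fastforce simp: coprod_def free_product_def sub_def)
    then show ?thesis
    proof (induction w)
      case Nil
      then show ?case by (simp add: copair_def)
    next
      case (Cons l w)
      have "case_sum (\<lambda>x. x) (\<lambda>y. y) l \<in> G1 a <#>\<^bsub>grp G a\<^esub> G2 a"
        using Cons.prems subset_set_mult by (auto simp: letters_def)
      then show ?case using Cons by (simp add: copair_def)
    qed
  qed
  then have "?f a ` elts ?P a \<subseteq> G1 a <#>\<^bsub>grp G a\<^esub> G2 a" by (rule image_subsetI)
  then show ?thesis unfolding surj by (rule equalityI[OF S.subset])
qed

lemma G12_pull: "\<phi> \<in> Hom A a b \<Longrightarrow> x \<in> G1 b \<Longrightarrow> pull G \<phi> x \<in> G1 a"
  "\<phi> \<in> Hom A a b \<Longrightarrow> y \<in> G2 b \<Longrightarrow> pull G \<phi> y \<in> G2 a"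
  using G1 G2 Hom_Obj[of \<phi> a b] by (auto simp: crossed_subgroup_def)

text \<open>Expanding \<open>\<phi>\<^sup>*(xy) = \<phi>\<^sup>*(yx)\<close> in both orders and comparing the components in \<open>G1\<close> and \<open>G2\<close>
  shows that the twists in \<open>\<phi>\<^sup>*(xy) = (\<phi>\<^sup>y)\<^sup>*(x) \<phi>\<^sup>*(y)\<close> disappear.\<close>

lemma pull_mult_components:
  assumes \<phi>: "\<phi> \<in> Hom A a b" and x: "x \<in> G1 b" and y: "y \<in> G2 b"
  shows "pull G \<phi> (x \<otimes>\<^bsub>grp G b\<^esub> y) = pull G \<phi> x \<otimes>\<^bsub>grp G a\<^esub> pull G \<phi> y"
proof -
  interpret a: commuting_subgroups "grp G a" "G1 a" "G2 a" by (rule commuting[OF Hom_Obj(1)[OF \<phi>]])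
  interpret b: commuting_subgroups "grp G b" "G1 b" "G2 b" by (rule commuting[OF Hom_Obj(2)[OF \<phi>]])
  note x' = b.X_closed[OF x] and y' = b.Y_closed[OF y]
  note c = G12_pull(1)[OF \<phi> x] G12_pull(2)[OF \<phi> y] G12_pull(1)[OF act_closed[OF \<phi> y'] x]
    G12_pull(2)[OF act_closed[OF \<phi> x'] y]
  have "pull G (act G y \<phi>) x \<otimes>\<^bsub>grp G a\<^esub> pull G \<phi> y = pull G \<phi> (x \<otimes>\<^bsub>grp G b\<^esub> y)"
    using pull_mult[OF \<phi> x' y'] by simp
  also have "\<dots> = pull G (act G x \<phi>) y \<otimes>\<^bsub>grp G a\<^esub> pull G \<phi> x"
    using pull_mult[OF \<phi> y' x'] b.comm[OF x y] by simp
  also have "\<dots> = pull G \<phi> x \<otimes>\<^bsub>grp G a\<^esub> pull G (act G x \<phi>) y"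
    using a.comm[OF c(1,4)] by simp
  finally have "pull G (act G y \<phi>) x = pull G \<phi> x" using a.mult_unique c by blast
  then show ?thesis using pull_mult[OF \<phi> x' y'] by simp
qed

section \<open>The correspondence for crossed subgroups and its inverse\<close>

lemma goursat_eq:
  "goursat A G G1 G2 H =
    (\<lambda>a\<in>Obj A. goursat_proj (grp G a) (G1 a) (G2 a) (H a), \<lambda>a\<in>Obj A. H a \<inter> G1 a,
     \<lambda>a\<in>Obj A. goursat_proj (grp G a) (G2 a) (G1 a) (H a), \<lambda>a\<in>Obj A. H a \<inter> G2 a,
     \<lambda>a\<in>Obj A. \<lambda>C\<in>(\<lambda>x. (H a \<inter> G1 a) #>\<^bsub>grp G a\<^esub> x) ` goursat_proj (grp G a) (G1 a) (G2 a) (H a).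
       goursat_iso (grp G a) (G2 a) (H a) C)"
proof -
  have swap: "(\<lambda>a\<in>Obj A. goursat_proj (grp G a) (G2 a) (G1 a) (H a)) =
      (\<lambda>a\<in>Obj A. {y \<in> G2 a. \<exists>x\<in>G1 a. x \<otimes>\<^bsub>grp G a\<^esub> y \<in> H a})"
    by (intro restrict_ext commuting_subgroups.proj_swap commuting)
  show ?thesis
    unfolding goursat_def Let_def prod.inject swap
    by (simp add: quot_grp_sub carrier_Mod_update goursat_proj_def goursat_iso_def cong: restrict_cong)
qed

text \<open>The inverse of \<open>goursat\<close>, as \<open>graph_of_goursat\<close> and
  \<open>goursat_graph_of\<close> establish.\<close>

definition graph_of ::
  "('o \<Rightarrow> 'g set) \<times> ('o \<Rightarrow> 'g set) \<times> ('o \<Rightarrow> 'g set) \<times> ('o \<Rightarrow> 'g set) \<times>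
    ('o \<Rightarrow> 'g set \<Rightarrow> 'g set) \<Rightarrow> 'o \<Rightarrow> 'g set" where
  "graph_of = (\<lambda>(K1, N1, K2, N2, \<chi>). \<lambda>a\<in>Obj A. goursat_graph (grp G a) (K1 a) (N1 a) (\<chi> a))"

lemma goursat_subgroup:
  assumes "H \<in> crossed_subgroups A G" "a \<in> Obj A"
  shows "goursat_subgroup (grp G a) (G1 a) (G2 a) (H a)"
  using assms commuting
  by (auto simp: goursat_subgroup_def goursat_subgroup_axioms_def crossed_subgroups_def
      crossed_subgroup_def)

lemma crossed_subgroups_pull:
  "H \<in> crossed_subgroups A G \<Longrightarrow> \<phi> \<in> Hom A a b \<Longrightarrow> h \<in> H b \<Longrightarrow> pull G \<phi> h \<in> H a"
  using Hom_Obj[of \<phi> a b] by (auto simp: crossed_subgroups_def crossed_subgroup_def)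

text \<open>Componentwise pullback carries a partner of an element to a partner of its
  pullback.\<close>

lemma proj_pull:
  assumes "H \<in> crossed_subgroups A G" "\<phi> \<in> Hom A a b"
  shows "x \<in> goursat_proj (grp G b) (G1 b) (G2 b) (H b) \<Longrightarrow>
      pull G \<phi> x \<in> goursat_proj (grp G a) (G1 a) (G2 a) (H a)"
    and "y \<in> goursat_proj (grp G b) (G2 b) (G1 b) (H b) \<Longrightarrow>
      pull G \<phi> y \<in> goursat_proj (grp G a) (G2 a) (G1 a) (H a)"
proof -
  note O = Hom_Obj[OF assms(2)]
  have p: "pull G \<phi> x \<otimes>\<^bsub>grp G a\<^esub> pull G \<phi> y \<in> H a"
    if "x \<in> G1 b" "y \<in> G2 b" "x \<otimes>\<^bsub>grp G b\<^esub> y \<in> H b" for x y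
    using crossed_subgroups_pull[OF assms that(3)] pull_mult_components[OF assms(2) that(1,2)] by simp
  show "x \<in> goursat_proj (grp G b) (G1 b) (G2 b) (H b) \<Longrightarrow>
      pull G \<phi> x \<in> goursat_proj (grp G a) (G1 a) (G2 a) (H a)"
    using p G12_pull[OF assms(2)] by (force simp: goursat_proj_def)
  show "y \<in> goursat_proj (grp G b) (G2 b) (G1 b) (H b) \<Longrightarrow>
      pull G \<phi> y \<in> goursat_proj (grp G a) (G2 a) (G1 a) (H a)"
    unfolding commuting_subgroups.proj_swap[OF commuting[OF O(1)]]
      commuting_subgroups.proj_swap[OF commuting[OF O(2)]]
    using p G12_pull[OF assms(2)] by force
qed

text \<open>Beyond the statements in each degree, only compatibility with pullback remains. For
  \<open>\<chi>\<close> it again amounts to pulling back partners.\<close>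

lemma goursat_in_data:
  assumes H: "H \<in> crossed_subgroups A G"
  shows "goursat A G G1 G2 H \<in> goursat_data A G G1 G2"
proof -
  define K1 where "K1 = (\<lambda>a\<in>Obj A. goursat_proj (grp G a) (G1 a) (G2 a) (H a))"
  define K2 where "K2 = (\<lambda>a\<in>Obj A. goursat_proj (grp G a) (G2 a) (G1 a) (H a))"
  define N1 where "N1 = (\<lambda>a\<in>Obj A. H a \<inter> G1 a)"
  define N2 where "N2 = (\<lambda>a\<in>Obj A. H a \<inter> G2 a)"
  define \<chi> where "\<chi> = (\<lambda>a\<in>Obj A. \<lambda>C\<in>(\<lambda>x. N1 a #>\<^bsub>grp G a\<^esub> x) ` K1 a.
    goursat_iso (grp G a) (G2 a) (H a) C)"
  have \<chi>': "\<chi> = (\<lambda>a\<in>Obj A. \<lambda>C\<in>(\<lambda>x. (H a \<inter> G1 a) #>\<^bsub>grp G a\<^esub> x) `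
      goursat_proj (grp G a) (G1 a) (G2 a) (H a). goursat_iso (grp G a) (G2 a) (H a) C)"
    by (auto simp: \<chi>_def N1_def K1_def intro!: restrict_ext)
  note gs = goursat_subgroup[OF H]
  note gs' = goursat_subgroup.swap_subgroup[OF gs]
  note defs = K1_def K2_def N1_def N2_def
  have K: "crossed_subgroup A G K1" "crossed_subgroup A G K2"
    using goursat_subgroup.proj_subgroup[OF gs] goursat_subgroup.proj_subgroup[OF gs']
      proj_pull[OF H]
    by (auto simp: crossed_subgroup_def defs)
  have "subgroup (H a \<inter> G1 a) (grp G a)" "subgroup (H a \<inter> G2 a) (grp G a)" if a: "a \<in> Obj A" for a
    using H G1 G2 a group.subgroups_Inter_pair[OF grp[OF a]]
    by (auto simp: crossed_subgroups_def crossed_subgroup_def)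
  then have N: "crossed_subgroup A G N1" "crossed_subgroup A G N2"
    using crossed_subgroups_pull[OF H] G12_pull by (auto simp: crossed_subgroup_def defs)
  have sub: "\<forall>a\<in>Obj A. N1 a \<subseteq> K1 a" "\<forall>a\<in>Obj A. N2 a \<subseteq> K2 a"
    using goursat_subgroup.Int_subset_proj[OF gs] goursat_subgroup.Int_subset_proj[OF gs']
    by (auto simp: defs)
  have sub': "\<forall>a\<in>Obj A. K1 a \<subseteq> G1 a" "\<forall>a\<in>Obj A. K2 a \<subseteq> G2 a"
    by (auto simp: defs goursat_proj_def)
  have NK: "crossed_subgroup A (sub G K1) N1" "crossed_subgroup A (sub G K2) N2"
    using crossed_subgroup_sub_iff[OF crossed_group_G] K N sub by auto
  have normal: "N1 a \<lhd> grp (sub G K1) a" "N2 a \<lhd> grp (sub G K2) a" if a: "a \<in> Obj A" for a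
    using goursat_subgroup.Int_normal[OF gs[OF a]] goursat_subgroup.Int_normal[OF gs'[OF a]] a
    by (simp_all add: defs sub_def)
  have iso: "\<chi> a \<in> iso (quot_grp (sub G K1) N1 a) (quot_grp (sub G K2) N2 a)" if a: "a \<in> Obj A" for a
  proof -
    have "group (quot_grp (sub G K1) N1 a)"
      using normal.factorgroup_is_group[OF normal(1)[OF a]] by (simp add: quot_grp_def)
    moreover have "\<chi> a = restrict (goursat_iso (grp G a) (G2 a) (H a))
        (carrier (quot_grp (sub G K1) N1 a))"
      using a by (simp add: \<chi>_def quot_grp_sub carrier_Mod_update)
    moreover have "goursat_iso (grp G a) (G2 a) (H a) \<in>
        iso (quot_grp (sub G K1) N1 a) (quot_grp (sub G K2) N2 a)"
      using goursat_subgroup.goursat_iso_iso[OF gs[OF a]] a by (simp add: quot_grp_sub defs)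
    ultimately show ?thesis by (simp add: restrict_iso_iff)
  qed
  have "\<chi> a (quot_pull A (sub G K1) N1 \<phi> C) = quot_pull A (sub G K2) N2 \<phi> (\<chi> b C)"
    if \<phi>: "\<phi> \<in> Hom A a b" and C: "C \<in> carrier (quot_grp (sub G K1) N1 b)" for a b \<phi> C
  proof -
    note O = Hom_Obj[OF \<phi>]
    from C obtain x where x: "x \<in> K1 b" "C = N1 b #>\<^bsub>grp G b\<^esub> x"
      by (auto simp: quot_grp_sub carrier_Mod_update)
    from x(1) obtain y where y: "x \<in> G1 b" "y \<in> G2 b" "x \<otimes>\<^bsub>grp G b\<^esub> y \<in> H b"
      using O by (auto simp: K1_def goursat_proj_def)
    then have yK: "y \<in> K2 b"
      using O commuting_subgroups.proj_swap[OF commuting[OF O(2)]] by (auto simp: K2_def)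
    \<comment> \<open>Any partner evaluates \<open>\<chi>\<close>; it is applied to
      \<open>x\<close>, \<open>y\<close> in degree \<open>b\<close> and to their pullbacks in degree
      \<open>a\<close>.\<close>
    have e: "\<chi> c (N1 c #>\<^bsub>grp G c\<^esub> x') = N2 c #>\<^bsub>grp G c\<^esub> y'"
      if "c \<in> Obj A" "x' \<in> K1 c" "x' \<in> G1 c" "y' \<in> G2 c" "x' \<otimes>\<^bsub>grp G c\<^esub> y' \<in> H c" for c x' y'
      using goursat_subgroup.goursat_iso_coset[OF gs[OF that(1)] that(3-5)] that(1,2)
      by (simp add: \<chi>_def N1_def N2_def)
    have px: "pull G \<phi> x \<in> K1 a" using K(1) x(1) \<phi> O by (auto simp: crossed_subgroup_def)
    have "pull G \<phi> x \<otimes>\<^bsub>grp G a\<^esub> pull G \<phi> y \<in> H a"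
      using pull_mult_components[OF \<phi> y(1,2)] crossed_subgroups_pull[OF H \<phi> y(3)] by simp
    then have "\<chi> a (N1 a #>\<^bsub>grp G a\<^esub> pull G \<phi> x) = N2 a #>\<^bsub>grp G a\<^esub> pull G \<phi> y"
      using e[OF O(1) px] G12_pull[OF \<phi>] y by blast
    then show ?thesis
      using quot_pull_sub[OF crossed_group_G K(1) NK(1) normal(1) \<phi> x(1)]
        quot_pull_sub[OF crossed_group_G K(2) NK(2) normal(2) \<phi> yK] e[OF O(2) x(1) y] x(2) by simp
  qed
  moreover have "\<chi> a C \<in> carrier (quot_grp (sub G K2) N2 a)"
    if "a \<in> Obj A" "C \<in> carrier (quot_grp (sub G K1) N1 a)" for a C
    using iso[OF that(1)] that(2) by (auto simp: iso_def hom_def)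
  ultimately have "presheaf_map A
      (\<lambda>a. carrier (quot_grp (sub G K1) N1 a)) (quot_pull A (sub G K1) N1)
      (\<lambda>a. carrier (quot_grp (sub G K2) N2 a)) (quot_pull A (sub G K2) N2) \<chi>"
    by (auto simp: presheaf_map_def)
  moreover have "\<chi> \<in> extensional (Obj A)"
    "\<forall>a\<in>Obj A. \<chi> a \<in> extensional (carrier (quot_grp (sub G K1) N1 a))"
    by (auto simp: \<chi>_def quot_grp_sub carrier_Mod_update)
  moreover have "K1 \<in> crossed_subgroups A (sub G G1)" "K2 \<in> crossed_subgroups A (sub G G2)"
    "N1 \<in> crossed_subgroups A (sub G K1)" "N2 \<in> crossed_subgroups A (sub G K2)"
    using K sub' NK crossed_subgroup_sub_iff[OF crossed_group_G G1] crossed_subgroup_sub_iff[OF crossed_group_G G2]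
    by (auto simp: crossed_subgroups_def) (auto simp: defs)
  ultimately have "(K1, N1, K2, N2, \<chi>) \<in> goursat_data A G G1 G2"
    using normal iso by (simp add: goursat_data_def)
  then show ?thesis by (simp add: goursat_eq \<chi>' defs)
qed

lemma graph_of_goursat:
  assumes H: "H \<in> crossed_subgroups A G"
  shows "graph_of (goursat A G G1 G2 H) = H"
proof (rule extensionalityI)
  show "graph_of (goursat A G G1 G2 H) \<in> extensional (Obj A)" by (simp add: graph_of_def goursat_eq)
  show "H \<in> extensional (Obj A)" using H by (simp add: crossed_subgroups_def)
  fix a assume a: "a \<in> Obj A"
  interpret goursat_subgroup "grp G a" "G1 a" "G2 a" "H a" by (rule goursat_subgroup[OF H a])
  have "goursat_graph (grp G a) (goursat_proj (grp G a) (G1 a) (G2 a) (H a)) (H a \<inter> G1 a)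
      (goursat_iso (grp G a) (G2 a) (H a)) = H a"
    using set_mult_eq[OF a] subgroup.subset[OF H] by (intro goursat_graph_goursat) auto
  \<comment> \<open>The graph evaluates \<open>\<chi>\<close> only at cosets of elements of the
    projection, where its restriction has no effect.\<close>
  moreover have "graph_of (goursat A G G1 G2 H) a =
      goursat_graph (grp G a) (goursat_proj (grp G a) (G1 a) (G2 a) (H a)) (H a \<inter> G1 a)
        (goursat_iso (grp G a) (G2 a) (H a))"
    unfolding graph_of_def goursat_eq using a by (auto intro!: goursat_graph_cong)
  ultimately show "graph_of (goursat A G G1 G2 H) a = H a" by simp
qed

context
  fixes K1 N1 K2 N2 \<chi>
  assumes data: "(K1, N1, K2, N2, \<chi>) \<in> goursat_data A G G1 G2"
begin

lemma data_crossed_subgroups: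
  "crossed_subgroup A G K1" "\<forall>a\<in>Obj A. K1 a \<subseteq> G1 a" "crossed_subgroup A (sub G K1) N1"
  "crossed_subgroup A G K2" "\<forall>a\<in>Obj A. K2 a \<subseteq> G2 a" "crossed_subgroup A (sub G K2) N2"
  using data
  by (simp_all add: goursat_data_def crossed_subgroups_def crossed_subgroup_sub_iff[OF crossed_group_G G1]
      crossed_subgroup_sub_iff[OF crossed_group_G G2])

lemma data_normal:
  "a \<in> Obj A \<Longrightarrow> N1 a \<lhd> grp (sub G K1) a" "a \<in> Obj A \<Longrightarrow> N2 a \<lhd> grp (sub G K2) a"
  using data by (simp_all add: goursat_data_def)

lemma data_quintuple:
  assumes "a \<in> Obj A"
  shows "goursat_quintuple (grp G a) (G1 a) (G2 a) (K1 a) (N1 a) (K2 a) (N2 a) (\<chi> a)"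
proof (intro goursat_quintuple.intro goursat_quintuple_axioms.intro commuting[OF assms])
  show "\<chi> a \<in> iso ((grp G a)\<lparr>carrier := K1 a\<rparr> Mod N1 a) ((grp G a)\<lparr>carrier := K2 a\<rparr> Mod N2 a)"
    using data assms by (simp add: goursat_data_def quot_grp_sub)
qed (use assms data_crossed_subgroups data_normal in \<open>auto simp: crossed_subgroup_def sub_def\<close>)

text \<open>Closure under pullback is the naturality of \<open>\<chi>\<close> read on
  representatives, combined with componentwise pullback of \<open>x \<otimes> y\<close>.\<close>

lemma graph_of_crossed_subgroup: "graph_of (K1, N1, K2, N2, \<chi>) \<in> crossed_subgroups A G"
proof -
  have "pull G \<phi> h \<in> goursat_graph (grp G a) (K1 a) (N1 a) (\<chi> a)"
    if \<phi>: "\<phi> \<in> Hom A a b" and h: "h \<in> goursat_graph (grp G b) (K1 b) (N1 b) (\<chi> b)" for a b \<phi> h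
  proof -
    note O = Hom_Obj[OF \<phi>]
    interpret a: goursat_quintuple "grp G a" "G1 a" "G2 a" "K1 a" "N1 a" "K2 a" "N2 a" "\<chi> a"
      by (rule data_quintuple[OF O(1)])
    interpret b: goursat_quintuple "grp G b" "G1 b" "G2 b" "K1 b" "N1 b" "K2 b" "N2 b" "\<chi> b"
      by (rule data_quintuple[OF O(2)])
    from h obtain x y where xy: "h = x \<otimes>\<^bsub>grp G b\<^esub> y" "x \<in> K1 b" "y \<in> K2 b"
      "y \<in> \<chi> b (N1 b #>\<^bsub>grp G b\<^esub> x)" by (rule b.graphE)
    have p: "pull G \<phi> x \<in> K1 a" "pull G \<phi> y \<in> K2 a"
      using data_crossed_subgroups(1,4) \<phi> O xy by (auto simp: crossed_subgroup_def)
    have "N1 b #>\<^bsub>grp G b\<^esub> x \<in> carrier (quot_grp (sub G K1) N1 b)"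
      using xy by (simp add: quot_grp_sub carrier_Mod_update)
    then have "\<chi> a (quot_pull A (sub G K1) N1 \<phi> (N1 b #>\<^bsub>grp G b\<^esub> x)) =
        quot_pull A (sub G K2) N2 \<phi> (\<chi> b (N1 b #>\<^bsub>grp G b\<^esub> x))"
      using data O \<phi> by (auto simp: goursat_data_def presheaf_map_def)
    moreover have "\<chi> b (N1 b #>\<^bsub>grp G b\<^esub> x) = N2 b #>\<^bsub>grp G b\<^esub> y" using xy b.mem_chi_iff by blast
    ultimately have "\<chi> a (N1 a #>\<^bsub>grp G a\<^esub> pull G \<phi> x) = N2 a #>\<^bsub>grp G a\<^esub> pull G \<phi> y"
      using quot_pull_sub[OF crossed_group_G data_crossed_subgroups(1,3) data_normal(1) \<phi> xy(2)]
        quot_pull_sub[OF crossed_group_G data_crossed_subgroups(4,6) data_normal(2) \<phi> xy(3)] by simp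
    then have "pull G \<phi> y \<in> \<chi> a (N1 a #>\<^bsub>grp G a\<^esub> pull G \<phi> x)"
      using p a.mem_chi_iff by blast
    then have "pull G \<phi> x \<otimes>\<^bsub>grp G a\<^esub> pull G \<phi> y \<in> a.graph"
      using p by (simp add: a.mult_mem_graph_iff)
    then show ?thesis using pull_mult_components[OF \<phi>, of x y] xy by simp
  qed
  then show ?thesis
    using goursat_quintuple.graph_subgroup[OF data_quintuple]
    by (auto simp: graph_of_def crossed_subgroups_def crossed_subgroup_def)
qed

lemma goursat_graph_of: "goursat A G G1 G2 (graph_of (K1, N1, K2, N2, \<chi>)) = (K1, N1, K2, N2, \<chi>)"
proof -
  have E: "K1 \<in> extensional (Obj A)" "N1 \<in> extensional (Obj A)" "K2 \<in> extensional (Obj A)"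
    "N2 \<in> extensional (Obj A)" "\<chi> \<in> extensional (Obj A)"
    using data by (auto simp: goursat_data_def crossed_subgroups_def)
  \<comment> \<open>\<open>\<chi>\<close> is extensional at two levels, in the object and in the
    coset; this settles the inner one.\<close>
  have "restrict (goursat_iso (grp G a) (G2 a) (goursat_graph (grp G a) (K1 a) (N1 a) (\<chi> a)))
      ((\<lambda>x. N1 a #>\<^bsub>grp G a\<^esub> x) ` K1 a) = \<chi> a" if a: "a \<in> Obj A" for a
  proof (rule extensionalityI)
    show "\<chi> a \<in> extensional ((\<lambda>x. N1 a #>\<^bsub>grp G a\<^esub> x) ` K1 a)"
      using data a by (auto simp: goursat_data_def quot_grp_sub carrier_Mod_update)
  qed (use goursat_quintuple.goursat_iso_graph[OF data_quintuple[OF a]] in auto)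
  then show ?thesis
    unfolding goursat_eq prod.inject
    using goursat_quintuple.proj_graph[OF data_quintuple]
      goursat_quintuple.proj_swap_graph[OF data_quintuple]
      goursat_quintuple.graph_Int[OF data_quintuple]
      goursat_quintuple.graph_Int_swap[OF data_quintuple]
    by (intro conjI; intro extensionalityI[OF _ E(1)] extensionalityI[OF _ E(2)]
        extensionalityI[OF _ E(3)] extensionalityI[OF _ E(4)] extensionalityI[OF _ E(5)])
      (simp_all add: graph_of_def)
qed

end

end

theorem theoremA3:
  fixes A :: "('o, 'm) cat"
    and G :: "('o, 'm, 'g) crossed"
    and G1 G2 :: "'o \<Rightarrow> 'g set"
  assumes "small_category A"
    and "crossed_group A G"
    and "crossed_subgroup A G G1" and "crossed_subgroup A G G2"
    and "virtual_product A G G1 G2"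
  shows "bij_betw (goursat A G G1 G2) (crossed_subgroups A G) (goursat_data A G G1 G2)"
proof -
  interpret virtual_product_crossed_group A G G1 G2
    using assms(2-)
    by (simp add: virtual_product_crossed_group_def virtual_product_crossed_group_axioms_def)
  show ?thesis
    by (rule bij_betw_byWitness[where f' = graph_of])
      (auto simp: graph_of_goursat goursat_graph_of goursat_in_data graph_of_crossed_subgroup)
qed

end
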